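(* Let $X$ be an Archimedean vector lattice with Dedekind completion $X^\delta$. The following are equivalent: (i) $X$ is strongly first countable; (ii) $X$ is $\sigma$-strongly first countable and has the countable supremum property; (iii) $X$ is $\sigma$-strongly first countable and almost $\sigma$-order complete; (iv) $X$ is almost $\sigma$-order complete and there exists a countable set $C\subseteq X_+$ such that for every sequence $x_n\downarrow0$ in $X$ there exists $D\subseteq C$ with $\bigwedge D=0$ and such that for every $d\in D$ there exists $n\in\mathbb N$ with $x_n\le d$; (v) $X^\delta$ is $\sigma$-strongly first countable; (vi) $X^\delta$ is strongly first countable.
   Context: Nets are indexed by pre-ordered upward directed sets. The tail filter $[x_\alpha]$ of a net consists of all sets containing some tail $\{x_\alpha:\alpha\ge\alpha_0\}$; a filter $\mathcal F$ converges to $x$ if $\mathcal F=[x_\alpha]$ for some net $x_\alpha\to x$. For a filter base $\mathcal B$, $[\mathcal B]$ is the filter it generates. A convergence structure is strongly first countable if for every $x$ there is a countable collection $\mathcal H$ of subsets such that whenever a filter $\mathcal F\to x$ there is a filter base $\mathcal B\subseteq\mathcal F\cap\mathcal H$ with $[\mathcal B]\to x$. On an Archimedean vector lattice, order convergence: $x_\alpha\xrightarrow{\mathrm{o}}x$ if there is a set $D$ with $\bigwedge D=0$ such that for every $d\in D$ there is $\alpha_d$ with $|x_\alpha-x|\le d$ for all $\alpha\ge\alpha_d$. $\sigma$-order convergence: the same with $D$ replaced by a sequence $(u_n)$ of positive elements with $\bigwedge_n u_n=0$. A vector lattice is called strongly first countable (resp. $\sigma$-strongly first countable) if order convergence (resp.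 $\sigma$-order convergence) on it is strongly first countable. $X$ has the countable supremum property if every $A\subseteq X$ with $\bigwedge A=0$ contains a countable $B\subseteq A$ with $\bigwedge B=0$. A sublattice $Y$ of $Z$ is super order dense in $Z$ if for every $0<z\in Z$ there is a sequence $(y_n)$ in $Y_+$ with $z=\bigvee_n y_n$. $X$ is almost $\sigma$-order complete (almost $\sigma$-complete) if there is a $\sigma$-order complete vector lattice containing $X$ as a super order dense sublattice. $x_n\downarrow0$ means decreasing with infimum $0$. *)

theory Defs
  imports Complex_Main "HOL-Library.Lattice_Algebras" "HOL-Library.Lub_Glb"
    "HOL-Library.Countable_Set"
begin

section \<open>Vector lattices\<close>

class vector_lattice = ordered_real_vector + lattice_ab_group_add_abs

class archimedean_vector_lattice = vector_lattice +
  assumes archimedean: "(\<And>n. real n *\<^sub>R x \<le> y) \<Longrightarrow> x \<le> 0"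

class dedekind_complete_vector_lattice = vector_lattice + conditionally_complete_lattice

text \<open>\<open>'b\<close>, with the embedding \<open>j\<close>, is a Dedekind completion of \<open>'a\<close>: the image of \<open>j\<close> is an order
  dense and majorizing vector sublattice. This determines \<open>'b\<close> up to isomorphism.\<close>

definition dedekind_completion ::
  "('a::archimedean_vector_lattice \<Rightarrow> 'b::dedekind_complete_vector_lattice) \<Rightarrow> bool" where
  "dedekind_completion j \<longleftrightarrow>
     linear j \<and> inj j \<and> (\<forall>x y. j (sup x y) = sup (j x) (j y)) \<and>
     (\<forall>z>0. \<exists>x. 0 < j x \<and> j x \<le> z) \<and>
     (\<forall>z. \<exists>x. z \<le> j x)"

definition countable_sup_property :: "'a::vector_lattice itself \<Rightarrow> bool" where
  "countable_sup_property _ \<longleftrightarrow>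
     (\<forall>A::'a set. isGlb UNIV A 0 \<longrightarrow> (\<exists>B\<subseteq>A. countable B \<and> isGlb UNIV B 0))"


section \<open>Nets, filters and convergence\<close>

text \<open>The index set of a net is a set \<open>I\<close> with a relation \<open>r\<close>; \<open>(i, k) \<in> r\<close> means \<open>i \<le> k\<close>.\<close>

definition directed_preorder_on :: "'i set \<Rightarrow> 'i rel \<Rightarrow> bool" where
  "directed_preorder_on I r \<longleftrightarrow> preorder_on I r \<and> I \<noteq> {} \<and>
     (\<forall>i\<in>I. \<forall>k\<in>I. \<exists>l\<in>I. (i, l) \<in> r \<and> (k, l) \<in> r)"

definition tail_filter :: "'i set \<Rightarrow> 'i rel \<Rightarrow> ('i \<Rightarrow> 'a) \<Rightarrow> 'a filter" where
  "tail_filter I r u = (INF i\<in>I. principal {u k |k. (i, k) \<in> r})"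

lemma eventually_tail_filter:
  assumes "directed_preorder_on I r"
  shows "eventually P (tail_filter I r u) \<longleftrightarrow> (\<exists>i\<in>I. \<forall>k. (i, k) \<in> r \<longrightarrow> P (u k))"
proof -
  have tr: "trans r" and ne: "I \<noteq> {}"
    and dir: "\<And>i k. i \<in> I \<Longrightarrow> k \<in> I \<Longrightarrow> \<exists>l\<in>I. (i, l) \<in> r \<and> (k, l) \<in> r"
    using assms by (auto simp: directed_preorder_on_def preorder_on_def)
  have "eventually P (tail_filter I r u) \<longleftrightarrow>
      (\<exists>i\<in>I. eventually P (principal {u k |k. (i, k) \<in> r}))"
    unfolding tail_filter_def
  proof (rule eventually_INF_base[OF ne])
    fix i k assume "i \<in> I" "k \<in> I"
    with dir obtain l where "l \<in> I" "(i, l) \<in> r" "(k, l) \<in> r" by blast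
    then show "\<exists>x\<in>I. principal {u k |k. (x, k) \<in> r}
        \<le> inf (principal {u k |k. (i, k) \<in> r}) (principal {u l |l. (k, l) \<in> r})"
      by (intro bexI[of _ l]) (auto intro: transD[OF tr])
  qed
  then show ?thesis
    by (simp add: eventually_principal) blast
qed

text \<open>A notion of convergence of nets induces one of filters: \<open>F\<close> converges to \<open>x\<close> if it is the tail
  filter of some net converging to \<open>x\<close>. The index type of that net cannot be quantified over; the
  type \<open>'a set \<times> 'a\<close> is large enough for every filter on \<open>'a\<close>, so that nothing is lost (see
  \<open>order_filter_convergesI\<close> and \<open>sigma_order_filter_convergesI\<close> below).\<close>

definition filter_converges ::
  "(('a set \<times> 'a) set \<Rightarrow> ('a set \<times> 'a) rel \<Rightarrow> ('a set \<times> 'a \<Rightarrow> 'a) \<Rightarrow> 'a \<Rightarrow> bool) \<Rightarrow>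
     'a filter \<Rightarrow> 'a \<Rightarrow> bool" where
  "filter_converges net_converges F x \<longleftrightarrow>
     (\<exists>I r u. directed_preorder_on I r \<and> F = tail_filter I r u \<and> net_converges I r u x)"

definition filter_base :: "'a set set \<Rightarrow> bool" where
  "filter_base B \<longleftrightarrow> B \<noteq> {} \<and> {} \<notin> B \<and> (\<forall>A1\<in>B. \<forall>A2\<in>B. \<exists>A3\<in>B. A3 \<subseteq> A1 \<inter> A2)"

definition generated_filter :: "'a set set \<Rightarrow> 'a filter" where
  "generated_filter B = (INF A\<in>B. principal A)"

definition strongly_first_countable :: "('a filter \<Rightarrow> 'a \<Rightarrow> bool) \<Rightarrow> bool" where
  "strongly_first_countable converges \<longleftrightarrow>
     (\<forall>x. \<exists>H::'a set set. countable H \<and>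
        (\<forall>F. converges F x \<longrightarrow>
           (\<exists>B. filter_base B \<and> B \<subseteq> {A \<in> H. eventually (\<lambda>y. y \<in> A) F} \<and>
                converges (generated_filter B) x)))"

definition order_converges ::
  "'i set \<Rightarrow> 'i rel \<Rightarrow> ('i \<Rightarrow> 'a::vector_lattice) \<Rightarrow> 'a \<Rightarrow> bool" where
  "order_converges I r u x \<longleftrightarrow>
     (\<exists>D. isGlb UNIV D 0 \<and> (\<forall>d\<in>D. \<exists>i\<in>I. \<forall>k. (i, k) \<in> r \<longrightarrow> \<bar>u k - x\<bar> \<le> d))"

definition sigma_order_converges ::
  "'i set \<Rightarrow> 'i rel \<Rightarrow> ('i \<Rightarrow> 'a::vector_lattice) \<Rightarrow> 'a \<Rightarrow> bool" where
  "sigma_order_converges I r u x \<longleftrightarrow>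
     (\<exists>d::nat \<Rightarrow> 'a. (\<forall>n. 0 \<le> d n) \<and> isGlb UNIV (range d) 0 \<and>
        (\<forall>n. \<exists>i\<in>I. \<forall>k. (i, k) \<in> r \<longrightarrow> \<bar>u k - x\<bar> \<le> d n))"

definition order_strongly_first_countable :: "'a::vector_lattice itself \<Rightarrow> bool" where
  "order_strongly_first_countable _ \<longleftrightarrow>
     strongly_first_countable (filter_converges order_converges :: 'a filter \<Rightarrow> 'a \<Rightarrow> bool)"

definition sigma_order_strongly_first_countable :: "'a::vector_lattice itself \<Rightarrow> bool" where
  "sigma_order_strongly_first_countable _ \<longleftrightarrow>
     strongly_first_countable (filter_converges sigma_order_converges :: 'a filter \<Rightarrow> 'a \<Rightarrow> bool)"

lemma tail_filter_neq_bot: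
  assumes "directed_preorder_on I r"
  shows "tail_filter I r u \<noteq> bot"
proof -
  have "(i, i) \<in> r" if "i \<in> I" for i
    using assms that by (auto simp: directed_preorder_on_def preorder_on_def refl_on_def)
  then show ?thesis
    unfolding trivial_limit_def eventually_tail_filter[OF assms] by blast
qed

lemma ex_net_with_tail_filter:
  fixes F :: "'a filter"
  assumes "F \<noteq> bot"
  shows "\<exists>(I::('a set \<times> 'a) set) r. directed_preorder_on I r \<and> F = tail_filter I r snd"
proof -
  define I where "I = {p::'a set \<times> 'a. eventually (\<lambda>y. y \<in> fst p) F \<and> snd p \<in> fst p}"
  define r where "r = {(p, q). p \<in> I \<and> q \<in> I \<and> fst q \<subseteq> fst p}"
  have mem: "\<exists>y. (A, y) \<in> I" if "eventually (\<lambda>y. y \<in> A) F" for A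
    using eventually_happens'[OF assms that] that by (auto simp: I_def)
  have pre: "preorder_on I r"
    by (auto simp: preorder_on_def refl_on_def trans_def r_def)
  have ne: "I \<noteq> {}"
    using mem[of UNIV] by auto
  have dir: "\<exists>s\<in>I. (p, s) \<in> r \<and> (q, s) \<in> r" if "p \<in> I" "q \<in> I" for p q
  proof -
    have "eventually (\<lambda>y. y \<in> fst p \<inter> fst q) F"
      using that by (auto simp: I_def eventually_conj_iff)
    from mem[OF this] obtain y where "(fst p \<inter> fst q, y) \<in> I" ..
    then show ?thesis
      using that by (intro bexI[of _ "(fst p \<inter> fst q, y)"]) (auto simp: r_def)
  qed
  have D: "directed_preorder_on I r"
    using pre ne dir by (auto simp: directed_preorder_on_def)
  have "eventually P F \<longleftrightarrow> eventually P (tail_filter I r snd)" for P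
    unfolding eventually_tail_filter[OF D]
  proof
    assume P: "eventually P F"
    then obtain y where y: "(Collect P, y) \<in> I"
      using mem[of "Collect P"] by auto
    then show "\<exists>p\<in>I. \<forall>q. (p, q) \<in> r \<longrightarrow> P (snd q)"
      by (intro bexI[OF _ y]) (auto simp: r_def I_def)
  next
    assume "\<exists>p\<in>I. \<forall>q. (p, q) \<in> r \<longrightarrow> P (snd q)"
    then obtain p where p: "p \<in> I" "\<And>q. (p, q) \<in> r \<Longrightarrow> P (snd q)" by blast
    have "P y" if "y \<in> fst p" for y
      using p(1) p(2)[of "(fst p, y)"] that by (auto simp: r_def I_def)
    then show "eventually P F"
      using p(1) by (auto simp: I_def elim: eventually_mono)
  qed
  then have "F = tail_filter I r snd"
    by (simp add: filter_eq_iff)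
  with D show ?thesis by blast
qed

lemma order_converges_iff_tail_filter:
  assumes "directed_preorder_on I r"
  shows "order_converges I r u x \<longleftrightarrow>
    (\<exists>D. isGlb UNIV D 0 \<and> (\<forall>d\<in>D. eventually (\<lambda>y. \<bar>y - x\<bar> \<le> d) (tail_filter I r u)))"
  by (simp add: order_converges_def eventually_tail_filter[OF assms])

lemma sigma_order_converges_iff_tail_filter:
  assumes "directed_preorder_on I r"
  shows "sigma_order_converges I r u x \<longleftrightarrow>
    (\<exists>d::nat \<Rightarrow> _. (\<forall>n. 0 \<le> d n) \<and> isGlb UNIV (range d) 0 \<and>
       (\<forall>n. eventually (\<lambda>y. \<bar>y - x\<bar> \<le> d n) (tail_filter I r u)))"
  by (simp add: sigma_order_converges_def eventually_tail_filter[OF assms])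

text \<open>The index type \<open>'i\<close> below is arbitrary.\<close>

lemma order_filter_convergesI:
  fixes u :: "'i \<Rightarrow> 'a::vector_lattice"
  assumes "directed_preorder_on I r" "order_converges I r u x"
  shows "filter_converges order_converges (tail_filter I r u) x"
proof -
  obtain J :: "('a set \<times> 'a) set" and s where J: "directed_preorder_on J s"
    and eq: "tail_filter I r u = tail_filter J s snd"
    using ex_net_with_tail_filter[OF tail_filter_neq_bot[OF assms(1)]] by blast
  have "order_converges J s snd x"
    using assms(2) unfolding order_converges_iff_tail_filter[OF assms(1)]
      order_converges_iff_tail_filter[OF J] eq .
  with J eq show ?thesis
    unfolding filter_converges_def by blast
qed

lemma sigma_order_filter_convergesI:
  fixes u :: "'i \<Rightarrow> 'a::vector_lattice"
  assumes "directed_preorder_on I r" "sigma_order_converges I r u x"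
  shows "filter_converges sigma_order_converges (tail_filter I r u) x"
proof -
  obtain J :: "('a set \<times> 'a) set" and s where J: "directed_preorder_on J s"
    and eq: "tail_filter I r u = tail_filter J s snd"
    using ex_net_with_tail_filter[OF tail_filter_neq_bot[OF assms(1)]] by blast
  have "sigma_order_converges J s snd x"
    using assms(2) unfolding sigma_order_converges_iff_tail_filter[OF assms(1)]
      sigma_order_converges_iff_tail_filter[OF J] eq .
  with J eq show ?thesis
    unfolding filter_converges_def by blast
qed


section \<open>Almost \<open>\<sigma>\<close>-order completeness\<close>

text \<open>The \<open>\<sigma>\<close>-order complete vector lattice in the definition of almost \<open>\<sigma>\<close>-order completeness is
  existentially quantified, so it is represented by an explicit carrier with explicit operations;
  \<open>(x, y) \<in> le\<close> means \<open>x \<le> y\<close>.\<close>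

definition lub_on :: "'z set \<Rightarrow> 'z rel \<Rightarrow> 'z set \<Rightarrow> 'z \<Rightarrow> bool" where
  "lub_on Z le A s \<longleftrightarrow> s \<in> Z \<and> (\<forall>a\<in>A. (a, s) \<in> le) \<and>
     (\<forall>t\<in>Z. (\<forall>a\<in>A. (a, t) \<in> le) \<longrightarrow> (s, t) \<in> le)"

locale vector_lattice_on =
  fixes Z :: "'z set" and add :: "'z \<Rightarrow> 'z \<Rightarrow> 'z" and zero :: 'z
    and scale :: "real \<Rightarrow> 'z \<Rightarrow> 'z" and le :: "'z rel"
  assumes add_closed: "x \<in> Z \<Longrightarrow> y \<in> Z \<Longrightarrow> add x y \<in> Z"
    and zero_closed: "zero \<in> Z"
    and scale_closed: "x \<in> Z \<Longrightarrow> scale a x \<in> Z"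
    and add_assoc: "x \<in> Z \<Longrightarrow> y \<in> Z \<Longrightarrow> z \<in> Z \<Longrightarrow> add (add x y) z = add x (add y z)"
    and add_commute: "x \<in> Z \<Longrightarrow> y \<in> Z \<Longrightarrow> add x y = add y x"
    and add_zero: "x \<in> Z \<Longrightarrow> add x zero = x"
    and add_inverse: "x \<in> Z \<Longrightarrow> \<exists>y\<in>Z. add x y = zero"
    and scale_add_right: "x \<in> Z \<Longrightarrow> y \<in> Z \<Longrightarrow> scale a (add x y) = add (scale a x) (scale a y)"
    and scale_add_left: "x \<in> Z \<Longrightarrow> scale (a + b) x = add (scale a x) (scale b x)"
    and scale_scale: "x \<in> Z \<Longrightarrow> scale a (scale b x) = scale (a * b) x"
    and scale_one: "x \<in> Z \<Longrightarrow> scale 1 x = x"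
    and partial_order: "partial_order_on Z le"
    and add_mono: "(x, y) \<in> le \<Longrightarrow> z \<in> Z \<Longrightarrow> (add x z, add y z) \<in> le"
    and scale_mono: "(x, y) \<in> le \<Longrightarrow> 0 \<le> a \<Longrightarrow> (scale a x, scale a y) \<in> le"
    and ex_sup: "x \<in> Z \<Longrightarrow> y \<in> Z \<Longrightarrow> \<exists>s. lub_on Z le {x, y} s"
    and ex_inf: "x \<in> Z \<Longrightarrow> y \<in> Z \<Longrightarrow> \<exists>s. lub_on Z (le\<inverse>) {x, y} s"

definition sigma_order_complete_on :: "'z set \<Rightarrow> 'z rel \<Rightarrow> bool" where
  "sigma_order_complete_on Z le \<longleftrightarrow>
     (\<forall>A\<subseteq>Z. A \<noteq> {} \<and> countable A \<and> (\<exists>t\<in>Z. \<forall>a\<in>A. (a, t) \<in> le) \<longrightarrow> (\<exists>s. lub_on Z le A s))"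

definition super_order_dense_embedding ::
  "('a::vector_lattice \<Rightarrow> 'z) \<Rightarrow> 'z set \<Rightarrow> ('z \<Rightarrow> 'z \<Rightarrow> 'z) \<Rightarrow> 'z \<Rightarrow> (real \<Rightarrow> 'z \<Rightarrow> 'z) \<Rightarrow> 'z rel \<Rightarrow> bool" where
  "super_order_dense_embedding j Z add zero scale le \<longleftrightarrow>
     range j \<subseteq> Z \<and> inj j \<and>
     (\<forall>x y. j (x + y) = add (j x) (j y)) \<and>
     (\<forall>a x. j (a *\<^sub>R x) = scale a (j x)) \<and>
     (\<forall>x y. lub_on Z le {j x, j y} (j (sup x y))) \<and>
     (\<forall>z\<in>Z. (zero, z) \<in> le \<and> z \<noteq> zero \<longrightarrow>
        (\<exists>y::nat \<Rightarrow> 'a. (\<forall>n. 0 \<le> y n) \<and> lub_on Z le (range (\<lambda>n. j (y n))) z))"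

text \<open>The type \<open>nat \<Rightarrow> 'a\<close> is large enough for every vector lattice in which \<open>'a\<close> is super order dense,
  so that fixing it loses nothing (see \<open>almost_sigma_order_completeI\<close>).\<close>

definition almost_sigma_order_complete :: "'a::vector_lattice itself \<Rightarrow> bool" where
  "almost_sigma_order_complete _ \<longleftrightarrow>
     (\<exists>(j :: 'a \<Rightarrow> nat \<Rightarrow> 'a) Z add zero scale le.
        vector_lattice_on Z add zero scale le \<and> sigma_order_complete_on Z le \<and>
        super_order_dense_embedding j Z add zero scale le)"

lemma map_prod_image_mem_iff:
  assumes inj: "inj_on f Z" and le: "le \<subseteq> Z \<times> Z" and xy: "x \<in> Z" "y \<in> Z"
  shows "(f x, f y) \<in> map_prod f f ` le \<longleftrightarrow> (x, y) \<in> le"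
proof
  assume "(f x, f y) \<in> map_prod f f ` le"
  then obtain x' y' where *: "(x', y') \<in> le" "f x = f x'" "f y = f y'" by auto
  with le have "x' \<in> Z" "y' \<in> Z" by auto
  with * xy inj have "x = x'" "y = y'" by (auto dest: inj_onD)
  with * show "(x, y) \<in> le" by simp
qed (rule map_prod_imageI)

lemma lub_on_image:
  assumes inj: "inj_on f Z" and le: "le \<subseteq> Z \<times> Z" and A: "A \<subseteq> Z" and s: "s \<in> Z"
  shows "lub_on (f ` Z) (map_prod f f ` le) (f ` A) (f s) \<longleftrightarrow> lub_on Z le A s"
proof -
  note mem = map_prod_image_mem_iff[OF inj le]
  then show ?thesis
    using A s by (auto simp: lub_on_def subset_iff mem simp del: map_prod_imageI)
qed

lemma (in vector_lattice_on) image: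
  assumes inj: "inj_on f Z"
  defines "g \<equiv> inv_into Z f"
  shows "vector_lattice_on (f ` Z) (\<lambda>x y. f (add (g x) (g y))) (f zero)
    (\<lambda>a x. f (scale a (g x))) (map_prod f f ` le)"
proof -
  have gf: "g (f x) = x" if "x \<in> Z" for x
    using that inj by (simp add: g_def)
  have leZ: "le \<subseteq> Z \<times> Z"
    using partial_order by (rule partial_order_onD)
  note le = map_prod_image_mem_iff[OF inj leZ]
  have conv: "(map_prod f f ` le)\<inverse> = map_prod f f ` (le\<inverse>)"
    by force
  note [simp] = gf add_closed zero_closed scale_closed
  show ?thesis
  proof
    show "partial_order_on (f ` Z) (map_prod f f ` le)"
    proof -
      have "refl_on Z le" "trans le" "antisym le"
        using partial_order by (auto dest: partial_order_onD)
      then have r: "\<And>x. x \<in> Z \<Longrightarrow> (x, x) \<in> le"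
        and t: "\<And>x y z. (x, y) \<in> le \<Longrightarrow> (y, z) \<in> le \<Longrightarrow> (x, z) \<in> le"
        and a: "\<And>x y. (x, y) \<in> le \<Longrightarrow> (y, x) \<in> le \<Longrightarrow> x = y"
        by (auto simp: refl_on_def dest: transD antisymD)
      have sub: "map_prod f f ` le \<subseteq> f ` Z \<times> f ` Z"
        using leZ by auto
      have "refl_on (f ` Z) (map_prod f f ` le)"
        using r by (auto simp: refl_on_def le)
      moreover have "trans (map_prod f f ` le)"
      proof (rule transI)
        fix p q s assume pq: "(p, q) \<in> map_prod f f ` le" and qs: "(q, s) \<in> map_prod f f ` le"
        with sub have "p \<in> f ` Z" "q \<in> f ` Z" "s \<in> f ` Z" by blast+
        then obtain p' q' s' where *: "p = f p'" "q = f q'" "s = f s'" "p' \<in> Z" "q' \<in> Z" "s' \<in> Z"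
          by auto
        from pq qs t show "(p, s) \<in> map_prod f f ` le"
          unfolding *(1-3) le[OF *(4,5)] le[OF *(5,6)] le[OF *(4,6)] by blast
      qed
      moreover have "antisym (map_prod f f ` le)"
      proof (rule antisymI)
        fix p q assume pq: "(p, q) \<in> map_prod f f ` le" and qp: "(q, p) \<in> map_prod f f ` le"
        with sub have "p \<in> f ` Z" "q \<in> f ` Z" by blast+
        then obtain p' q' where *: "p = f p'" "q = f q'" "p' \<in> Z" "q' \<in> Z" by auto
        from pq qp have "p' = q'"
          unfolding *(1,2) le[OF *(3,4)] le[OF *(4,3)] by (rule a)
        then show "p = q" by (simp add: *)
      qed
      ultimately show ?thesis
        using sub by (simp add: partial_order_on_def preorder_on_def)
    qed
  next
    fix x y z assume xy: "(x, y) \<in> map_prod f f ` le" and z: "z \<in> f ` Z"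
    from xy leZ obtain x' y' where "x = f x'" "y = f y'" "(x', y') \<in> le" "x' \<in> Z" "y' \<in> Z" by auto
    with z show "(f (add (g x) (g z)), f (add (g y) (g z))) \<in> map_prod f f ` le"
      by (auto simp: le add_mono)
  next
    fix x y and a :: real assume xy: "(x, y) \<in> map_prod f f ` le" and a: "0 \<le> a"
    from xy leZ obtain x' y' where "x = f x'" "y = f y'" "(x', y') \<in> le" "x' \<in> Z" "y' \<in> Z" by auto
    with a show "(f (scale a (g x)), f (scale a (g y))) \<in> map_prod f f ` le"
      by (auto simp: le scale_mono)
  next
    fix x y assume "x \<in> f ` Z" "y \<in> f ` Z"
    then obtain x' y' where *: "x = f x'" "y = f y'" "x' \<in> Z" "y' \<in> Z" by auto
    obtain s where s: "lub_on Z le {x', y'} s" using ex_sup *(3,4) by blast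
    then have "s \<in> Z" by (simp add: lub_on_def)
    with s lub_on_image[OF inj leZ, of "{x', y'}" s] *
    show "\<exists>s. lub_on (f ` Z) (map_prod f f ` le) {x, y} s" by auto
    obtain i where i: "lub_on Z (le\<inverse>) {x', y'} i" using ex_inf *(3,4) by blast
    then have "i \<in> Z" by (simp add: lub_on_def)
    moreover have "le\<inverse> \<subseteq> Z \<times> Z" using leZ by auto
    ultimately show "\<exists>s. lub_on (f ` Z) ((map_prod f f ` le)\<inverse>) {x, y} s"
      using i lub_on_image[OF inj, of "le\<inverse>" "{x', y'}" i] * unfolding conv by auto
  next
    fix x assume "x \<in> f ` Z"
    then obtain x' where x': "x = f x'" "x' \<in> Z" by auto
    then obtain y' where "y' \<in> Z" "add x' y' = zero" using add_inverse by blast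
    with x' show "\<exists>y\<in>f ` Z. f (add (g x) (g y)) = f zero" by auto
  next
    fix x y assume "x \<in> f ` Z" "y \<in> f ` Z"
    then show "f (add (g x) (g y)) = f (add (g y) (g x))"
      using add_commute by auto
  qed (auto simp: add_assoc add_zero scale_add_right scale_add_left scale_scale scale_one)
qed

text \<open>The carrier type \<open>'z\<close> below is arbitrary.\<close>

lemma almost_sigma_order_completeI:
  fixes j :: "'a::vector_lattice \<Rightarrow> 'z"
  assumes V: "vector_lattice_on Z add zero scale le"
    and S: "sigma_order_complete_on Z le"
    and E: "super_order_dense_embedding j Z add zero scale le"
  shows "almost_sigma_order_complete TYPE('a)"
proof -
  interpret vector_lattice_on Z add zero scale le by (fact V)
  have leZ: "le \<subseteq> Z \<times> Z" and anti: "antisym le" and refl: "refl_on Z le"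
    using partial_order by (auto dest: partial_order_onD)
  have jZ: "j x \<in> Z" and injj: "inj j"
    and jadd: "j (x + y) = add (j x) (j y)"
    and jscale: "j (a *\<^sub>R x) = scale a (j x)"
    and jsup: "lub_on Z le {j x, j y} (j (sup x y))"
    for x y a
    using E by (auto simp: super_order_dense_embedding_def)
  have dense: "\<exists>y::nat \<Rightarrow> 'a. (\<forall>n. 0 \<le> y n) \<and> lub_on Z le (range (\<lambda>n. j (y n))) z"
    if "z \<in> Z" "(zero, z) \<in> le" "z \<noteq> zero" for z
    using E that by (auto simp: super_order_dense_embedding_def)
  have lub_unique: "s = t" if "lub_on Z le A s" "lub_on Z le A t" for A s t
    using that antisymD[OF anti] by (auto simp: lub_on_def)
  have cancel: "x = y" 
    if xyz: "x \<in> Z" "y \<in> Z" "z \<in> Z" and eq: "add x z = add y z" for x y z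
  proof -
    obtain w where w: "w \<in> Z" "add z w = zero" using add_inverse[OF \<open>z \<in> Z\<close>] by blast
    have "x = add (add x z) w" using xyz w by (simp add: add_assoc add_zero)
    also have "\<dots> = add (add y z) w" by (simp add: eq)
    also have "\<dots> = y" using xyz w by (simp add: add_assoc add_zero)
    finally show ?thesis .
  qed
  have j0: "j 0 = zero"
  proof -
    have "add (j 0) (j 0) = add zero (j 0)"
      using jadd[of 0 0] jZ by (simp add: add_commute[OF zero_closed] add_zero)
    then show ?thesis using cancel jZ zero_closed by blast
  qed
  have dense0: "\<exists>y::nat \<Rightarrow> 'a. lub_on Z le (range (\<lambda>n. j (y n))) z"
    if "(zero, z) \<in> le" for z
  proof (cases "z = zero")
    case True
    have "lub_on Z le (range (\<lambda>n::nat. j 0)) z"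
      using zero_closed refl by (auto simp: True j0 lub_on_def refl_on_def)
    then show ?thesis by (intro exI[of _ "\<lambda>_. 0"]) simp
  next
    case False
    with that leZ dense show ?thesis by blast
  qed
  have decomp: "\<exists>p q. (zero, p) \<in> le \<and> (zero, q) \<in> le \<and> add q z = p" if z: "z \<in> Z" for z
  proof -
    obtain p where p: "lub_on Z le {zero, z} p" using ex_sup zero_closed z by blast
    then have pZ: "p \<in> Z" "(zero, p) \<in> le" "(z, p) \<in> le" by (auto simp: lub_on_def)
    obtain w where w: "w \<in> Z" "add z w = zero" using add_inverse z by blast
    have "(zero, add p w) \<in> le" using add_mono[OF pZ(3) w(1)] w by simp
    moreover have "add (add p w) z = p"
      using pZ w z by (simp add: add_assoc add_commute[of w z] add_zero)
    ultimately show ?thesis using pZ by blast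
  qed
  have "\<exists>h::nat \<Rightarrow> 'a. \<exists>p q. lub_on Z le (range (\<lambda>n. j (h (2 * n)))) p \<and>
      lub_on Z le (range (\<lambda>n. j (h (2 * n + 1)))) q \<and> add q z = p" if z: "z \<in> Z" for z
  proof -
    obtain p q where pq: "(zero, p) \<in> le" "(zero, q) \<in> le" "add q z = p"
      using decomp z by blast
    obtain a b :: "nat \<Rightarrow> 'a" where ab: "lub_on Z le (range (\<lambda>n. j (a n))) p"
        "lub_on Z le (range (\<lambda>n. j (b n))) q"
      using dense0 pq by meson
    define h where "h n = (if even n then a (n div 2) else b (n div 2))" for n
    have "(\<lambda>n. j (h (2 * n))) = (\<lambda>n. j (a n))" "(\<lambda>n. j (h (2 * n + 1))) = (\<lambda>n. j (b n))"
      by (auto simp: h_def)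
    with ab pq show ?thesis by metis
  qed
  then obtain f :: "'z \<Rightarrow> nat \<Rightarrow> 'a" where f: "\<And>z. z \<in> Z \<Longrightarrow> \<exists>p q.
      lub_on Z le (range (\<lambda>n. j (f z (2 * n)))) p \<and>
      lub_on Z le (range (\<lambda>n. j (f z (2 * n + 1)))) q \<and> add q z = p"
    by metis
  have inj: "inj_on f Z"
  proof (rule inj_onI)
    fix z z' assume z: "z \<in> Z" "z' \<in> Z" "f z = f z'"
    from f[OF z(1)] obtain p q where 1: "lub_on Z le (range (\<lambda>n. j (f z (2 * n)))) p"
      "lub_on Z le (range (\<lambda>n. j (f z (2 * n + 1)))) q" "add q z = p" by blast
    from f[OF z(2)] obtain p' q' where 2: "lub_on Z le (range (\<lambda>n. j (f z' (2 * n)))) p'"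
      "lub_on Z le (range (\<lambda>n. j (f z' (2 * n + 1)))) q'" "add q' z' = p'" by blast
    have "p = p'" "q = q'"
      using lub_unique 1(1,2) 2(1,2) z(3) by auto
    moreover have "q \<in> Z" using 1 by (simp add: lub_on_def)
    ultimately show "z = z'"
      using 1(3) 2(3) z(1,2) cancel[of z z' q] add_commute by metis
  qed
  define g where "g = inv_into Z f"
  have gf: "g (f x) = x" if "x \<in> Z" for x
    using that inj by (simp add: g_def)
  note le = map_prod_image_mem_iff[OF inj leZ]
  have 1: "vector_lattice_on (f ` Z) (\<lambda>x y. f (add (g x) (g y))) (f zero)
      (\<lambda>a x. f (scale a (g x))) (map_prod f f ` le)"
    unfolding g_def by (rule image[OF inj])
  have 2: "sigma_order_complete_on (f ` Z) (map_prod f f ` le)"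
    unfolding sigma_order_complete_on_def
  proof (intro allI impI)
    fix A assume A: "A \<subseteq> f ` Z"
      and *: "A \<noteq> {} \<and> countable A \<and> (\<exists>t\<in>f ` Z. \<forall>a\<in>A. (a, t) \<in> map_prod f f ` le)"
    define B where "B = g ` A"
    have BZ: "B \<subseteq> Z" and AB: "A = f ` B"
      using A gf by (force simp: B_def)+
    have "B \<noteq> {}" "countable B" using * by (auto simp: B_def)
    moreover have "\<exists>t\<in>Z. \<forall>a\<in>B. (a, t) \<in> le"
      using * BZ by (auto simp: AB le subset_iff)
    ultimately obtain s where s: "lub_on Z le B s"
      using S BZ unfolding sigma_order_complete_on_def by blast
    then have "s \<in> Z" by (simp add: lub_on_def)
    with s lub_on_image[OF inj leZ BZ] show "\<exists>s. lub_on (f ` Z) (map_prod f f ` le) A s"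
      by (auto simp: AB)
  qed
  have 3: "super_order_dense_embedding (\<lambda>x. f (j x)) (f ` Z) (\<lambda>x y. f (add (g x) (g y))) (f zero)
      (\<lambda>a x. f (scale a (g x))) (map_prod f f ` le)"
    unfolding super_order_dense_embedding_def
  proof (intro conjI allI ballI impI)
    show "range (\<lambda>x. f (j x)) \<subseteq> f ` Z" using jZ by auto
    show "inj (\<lambda>x. f (j x))" using injj jZ inj by (auto simp: inj_on_def)
    fix x y :: 'a and a :: real
    show "f (j (x + y)) = f (add (g (f (j x))) (g (f (j y))))"
      by (simp add: gf jZ jadd)
    show "f (j (a *\<^sub>R x)) = f (scale a (g (f (j x))))"
      by (simp add: gf jZ jscale)
    show "lub_on (f ` Z) (map_prod f f ` le) {f (j x), f (j y)} (f (j (sup x y)))"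
      using lub_on_image[OF inj leZ, of "{j x, j y}" "j (sup x y)"] jsup[of x y] jZ by simp
  next
    fix z assume z: "z \<in> f ` Z" and pos: "(f zero, z) \<in> map_prod f f ` le \<and> z \<noteq> f zero"
    from z obtain w where w: "w \<in> Z" "z = f w" by blast
    with pos have "(zero, w) \<in> le" "w \<noteq> zero"
      using zero_closed by (auto simp: le)
    then obtain y :: "nat \<Rightarrow> 'a" where y: "\<forall>n. 0 \<le> y n" "lub_on Z le (range (\<lambda>n. j (y n))) w"
      using dense w by blast
    have "range (\<lambda>n. j (y n)) \<subseteq> Z" using jZ by auto
    from lub_on_image[OF inj leZ this w(1)] y(2)
    have "lub_on (f ` Z) (map_prod f f ` le) (range (\<lambda>n. f (j (y n)))) z"
      by (simp add: w image_image)
    with y(1) show "\<exists>y::nat \<Rightarrow> 'a. (\<forall>n. 0 \<le> y n) \<and>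
        lub_on (f ` Z) (map_prod f f ` le) (range (\<lambda>n. f (j (y n)))) z" by blast
  qed
  from 1 2 3 show ?thesis
    unfolding almost_sigma_order_complete_def by blast
qed

end

theory Submission
  imports Defs
begin

text \<open>Strong first countability of order convergence is equivalent to the conjunction of the countable
  supremum property and the domination condition in (iv), called \<open>countable_domination\<close> below.
  Applying the local basis at \<open>0\<close> to the filter generated by the intervals \<open>[-d, d]\<close>, \<open>d \<in> D\<close>, yields a
  countable subset of \<open>D\<close> with infimum \<open>0\<close>; under the countable supremum property order and
  \<open>\<sigma>\<close>-order convergence of filters coincide; and conversely the finite intersections of the
  intervals given by \<open>C\<close> form a countable local basis. An almost \<open>\<sigma>\<close>-order complete space with
  \<open>countable_domination\<close> has the countable supremum property. Finally, both properties pass between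
  a space and its Dedekind completion, because under the countable supremum property every element
  of the completion is a countable infimum, or supremum, of elements of the space.\<close>

section \<open>Infima equal to zero\<close>

lemma isGlb_greatest:
  assumes "isGlb UNIV A x" and "\<And>a. a \<in> A \<Longrightarrow> l \<le> a"
  shows "l \<le> x"
  using isGlb_le_isLb[OF assms(1), of l] assms(2) by (simp add: isLb_def setge_def)

lemma isGlbI:
  fixes x :: "'a::preorder"
  assumes "\<And>a. a \<in> A \<Longrightarrow> x \<le> a" and "\<And>l. (\<And>a. a \<in> A \<Longrightarrow> l \<le> a) \<Longrightarrow> l \<le> x"
  shows "isGlb UNIV A x"
  using assms by (auto simp: isGlb_def greatestP_def isLb_def setge_def setle_def)

text \<open>A lower bound \<open>l\<close> of nonnegative elements can be raised to
  \<open>sup l 0\<close>. For nonnegative \<open>l\<close> one has \<bar>l\<bar> = l, so that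
  \<open>l\<close> can be tested as a point of the intervals [-d, d].\<close>

lemma isGlb_zeroI:
  fixes A :: "'a::vector_lattice set"
  assumes "\<And>a. a \<in> A \<Longrightarrow> 0 \<le> a"
    and "\<And>l. 0 \<le> l \<Longrightarrow> (\<And>a. a \<in> A \<Longrightarrow> l \<le> a) \<Longrightarrow> l \<le> 0"
  shows "isGlb UNIV A 0"
proof (rule isGlbI)
  fix l assume "\<And>a. a \<in> A \<Longrightarrow> l \<le> a"
  then have "sup l 0 \<le> 0" using assms by (intro assms(2)) auto
  then show "l \<le> 0" by simp
qed (rule assms(1))

lemma isGlb_zero_coinitial:
  fixes A :: "'a::vector_lattice set"
  assumes "isGlb UNIV A 0" "\<And>b. b \<in> B \<Longrightarrow> 0 \<le> b" "\<And>a. a \<in> A \<Longrightarrow> \<exists>b\<in>B. b \<le> a"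
  shows "isGlb UNIV B 0"
proof (rule isGlb_zeroI)
  fix l assume "\<And>b. b \<in> B \<Longrightarrow> l \<le> b"
  then show "l \<le> 0" using assms(1,3) by (meson isGlb_greatest order_trans)
qed (rule assms(2))

text \<open>Running infima along an enumeration of \<open>S\<close>, started at a member of
  \<open>T\<close>; they stay in \<open>T\<close> but may leave \<open>S\<close>.\<close>

lemma countable_coinitial_decseq:
  fixes S :: "'a::lattice set"
  assumes "countable S" "S \<subseteq> T" "T \<noteq> {}"
    and inf: "\<And>a b. a \<in> T \<Longrightarrow> b \<in> T \<Longrightarrow> inf a b \<in> T"
  shows "\<exists>s::nat \<Rightarrow> 'a. decseq s \<and> range s \<subseteq> T \<and> (\<forall>a\<in>S. \<exists>n. s n \<le> a)"
proof -
  obtain t where t: "t \<in> T" using assms(3) by blast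
  \<comment> \<open>The member \<open>t\<close> keeps the enumerated set nonempty when
    \<open>S\<close> is empty.\<close>
  define e where "e = from_nat_into (insert t S)"
  have e: "range e = insert t S"
    unfolding e_def using assms(1) by (intro range_from_nat_into) auto
  define s where "s = rec_nat t (\<lambda>n x. inf x (e n))"
  have Suc: "s (Suc n) = inf (s n) (e n)" for n by (simp add: s_def)
  have "s n \<in> T" for n
  proof (induction n)
    case (Suc n)
    have "e n \<in> T" using e t assms(2) by (metis insert_subset rangeI subsetD)
    with Suc inf show ?case by (simp add: \<open>s (Suc n) = inf (s n) (e n)\<close>)
  qed (simp add: s_def t)
  moreover have "decseq s" by (rule decseq_SucI) (simp add: Suc)
  moreover have "\<exists>n. s n \<le> a" if "a \<in> S" for a
  proof -
    have "a \<in> range e" using that e by simp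
    then obtain n where "a = e n" by blast
    then have "s (Suc n) \<le> a" by (simp add: Suc)
    then show ?thesis ..
  qed
  ultimately show ?thesis by blast
qed

text \<open>Pitfall: in the zero space the empty set has infimum \<open>0\<close>, hence the hypothesis \<open>T \<noteq> {}\<close>.\<close>

lemma countable_sup_property_decseq:
  fixes T :: "'a::vector_lattice set"
  assumes "countable_sup_property TYPE('a)" "isGlb UNIV T 0" "T \<noteq> {}"
    and "\<And>a b. a \<in> T \<Longrightarrow> b \<in> T \<Longrightarrow> inf a b \<in> T"
  shows "\<exists>s::nat \<Rightarrow> 'a. decseq s \<and> range s \<subseteq> T \<and> isGlb UNIV (range s) 0"
proof -
  obtain S where S: "S \<subseteq> T" "countable S" "isGlb UNIV S 0"
    using assms(1,2) unfolding countable_sup_property_def by blast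
  from countable_coinitial_decseq[OF S(2,1) assms(3,4)]
  obtain s where s: "decseq s" "range s \<subseteq> T" "\<forall>a\<in>S. \<exists>n. s n \<le> a" by blast
  have "isGlb UNIV (range s) 0"
    using s isGlbD2[OF assms(2)] by (intro isGlb_zero_coinitial[OF S(3)]) blast+
  with s show ?thesis by blast
qed


section \<open>Convergence of filters\<close>

definition eventual_bounds :: "'a::vector_lattice filter \<Rightarrow> 'a \<Rightarrow> 'a set" where
  "eventual_bounds F x = {d. eventually (\<lambda>y. \<bar>y - x\<bar> \<le> d) F}"

lemma eventual_bounds_nonneg:
  assumes "F \<noteq> bot" "d \<in> eventual_bounds F x"
  shows "0 \<le> d"
proof -
  obtain y where "\<bar>y - x\<bar> \<le> d"
    using assms eventually_happens' by (auto simp: eventual_bounds_def)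
  then show ?thesis using abs_ge_zero order_trans by blast
qed

lemma inf_eventual_bounds:
  "a \<in> eventual_bounds F x \<Longrightarrow> b \<in> eventual_bounds F x \<Longrightarrow> inf a b \<in> eventual_bounds F x"
  by (simp add: eventual_bounds_def eventually_conj_iff)

text \<open>Without eventual bounds every element is a lower bound, hence at most 0; but then 0
  itself is an eventual bound.\<close>

lemma eventual_bounds_nonempty:
  assumes "isGlb UNIV (eventual_bounds F x) 0"
  shows "eventual_bounds F x \<noteq> {}"
proof
  assume *: "eventual_bounds F x = {}"
  have "y \<le> 0" for y :: 'a by (rule isGlb_greatest[OF assms]) (simp add: *)
  then have "0 \<in> eventual_bounds F x" by (simp add: eventual_bounds_def)
  with * show False by simp
qed

text \<open>A witnessing set lies in \<open>eventual_bounds F x\<close>, whose further members are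
  nonnegative and leave the infimum at 0. Conversely, every proper filter is the tail filter of a
  net.\<close>

lemma filter_converges_order_iff:
  fixes x :: "'a::vector_lattice"
  shows "filter_converges order_converges F x \<longleftrightarrow> F \<noteq> bot \<and> isGlb UNIV (eventual_bounds F x) 0"
proof
  assume "filter_converges order_converges F x"
  then obtain I :: "('a set \<times> 'a) set" and r and u :: "'a set \<times> 'a \<Rightarrow> 'a"
    where D: "directed_preorder_on I r" and F: "F = tail_filter I r u"
    and "order_converges I r u x"
    unfolding filter_converges_def by blast
  then obtain D where D': "isGlb UNIV D 0" "D \<subseteq> eventual_bounds F x"
    unfolding order_converges_iff_tail_filter[OF D] eventual_bounds_def by blast
  have "F \<noteq> bot" unfolding F by (rule tail_filter_neq_bot[OF D])
  moreover from this have "isGlb UNIV (eventual_bounds F x) 0"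
    using D' by (intro isGlb_zero_coinitial[OF D'(1)]) (auto intro: eventual_bounds_nonneg)
  ultimately show "F \<noteq> bot \<and> isGlb UNIV (eventual_bounds F x) 0" by blast
next
  assume *: "F \<noteq> bot \<and> isGlb UNIV (eventual_bounds F x) 0"
  then obtain I :: "('a set \<times> 'a) set" and r where
    D: "directed_preorder_on I r" and F: "F = tail_filter I r snd"
    using ex_net_with_tail_filter by blast
  have "order_converges I r snd x"
    unfolding order_converges_iff_tail_filter[OF D] F[symmetric]
    using * by (intro exI[of _ "eventual_bounds F x"]) (simp add: eventual_bounds_def)
  with D F show "filter_converges order_converges F x"
    unfolding filter_converges_def by blast
qed

lemma filter_converges_sigma_order_iff:
  fixes x :: "'a::vector_lattice"
  shows "filter_converges sigma_order_converges F x \<longleftrightarrow>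
    F \<noteq> bot \<and> (\<exists>D. countable D \<and> D \<subseteq> eventual_bounds F x \<and> isGlb UNIV D 0)"
proof
  assume "filter_converges sigma_order_converges F x"
  then obtain I :: "('a set \<times> 'a) set" and r and u :: "'a set \<times> 'a \<Rightarrow> 'a"
    where D: "directed_preorder_on I r" and F: "F = tail_filter I r u"
    and "sigma_order_converges I r u x"
    unfolding filter_converges_def by blast
  then obtain d :: "nat \<Rightarrow> 'a" where d: "isGlb UNIV (range d) 0" "range d \<subseteq> eventual_bounds F x"
    unfolding sigma_order_converges_iff_tail_filter[OF D] eventual_bounds_def by blast
  have "F \<noteq> bot" unfolding F by (rule tail_filter_neq_bot[OF D])
  then show "F \<noteq> bot \<and> (\<exists>D. countable D \<and> D \<subseteq> eventual_bounds F x \<and> isGlb UNIV D 0)"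
    using d by (intro conjI exI[of _ "range d"]) auto
next
  assume "F \<noteq> bot \<and> (\<exists>D. countable D \<and> D \<subseteq> eventual_bounds F x \<and> isGlb UNIV D 0)"
  then obtain E where bot: "F \<noteq> bot"
    and E: "countable E" "E \<subseteq> eventual_bounds F x" "isGlb UNIV E 0" by blast
  obtain I :: "('a set \<times> 'a) set" and r where
    D: "directed_preorder_on I r" and F: "F = tail_filter I r snd"
    using ex_net_with_tail_filter bot by blast
  have "isGlb UNIV (eventual_bounds F x) 0"
    using E(2) bot by (intro isGlb_zero_coinitial[OF E(3)]) (auto intro: eventual_bounds_nonneg)
  then have "eventual_bounds F x \<noteq> {}" by (rule eventual_bounds_nonempty)
  \<comment> \<open>In the zero space \<open>E\<close> may be empty and so not the range of a
    sequence; the nonempty, inf-closed set of eventual bounds supplies one in every case.\<close>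
  from countable_coinitial_decseq[OF E(1,2) this inf_eventual_bounds]
  obtain d :: "nat \<Rightarrow> 'a" where d: "range d \<subseteq> eventual_bounds F x" "\<forall>a\<in>E. \<exists>n. d n \<le> a"
    by blast
  have "isGlb UNIV (range d) 0"
    using d bot by (intro isGlb_zero_coinitial[OF E(3)]) (auto intro: eventual_bounds_nonneg)
  moreover have "0 \<le> d n" for n
    using d(1) bot by (auto intro: eventual_bounds_nonneg)
  moreover have "eventually (\<lambda>y. \<bar>y - x\<bar> \<le> d n) F" for n
    using d(1) by (auto simp: eventual_bounds_def)
  ultimately have "sigma_order_converges I r snd x"
    unfolding sigma_order_converges_iff_tail_filter[OF D] F[symmetric] by blast
  with D F show "filter_converges sigma_order_converges F x"
    unfolding filter_converges_def by blast
qed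

lemma filter_converges_order_eq_sigma:
  assumes "countable_sup_property TYPE('a::vector_lattice)"
  shows "(filter_converges order_converges :: 'a filter \<Rightarrow> 'a \<Rightarrow> bool) =
    filter_converges sigma_order_converges"
proof (intro ext iffI)
  fix F and x :: 'a
  assume "filter_converges order_converges F x"
  then show "filter_converges sigma_order_converges F x"
    using assms unfolding filter_converges_order_iff filter_converges_sigma_order_iff
      countable_sup_property_def by blast
next
  fix F and x :: 'a
  assume "filter_converges sigma_order_converges F x"
  then obtain D where *: "F \<noteq> bot" "D \<subseteq> eventual_bounds F x" "isGlb UNIV D 0"
    unfolding filter_converges_sigma_order_iff by blast
  then show "filter_converges order_converges F x"
    unfolding filter_converges_order_iff
    by (auto intro: isGlb_zero_coinitial eventual_bounds_nonneg)
qed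

section \<open>Filters generated by a base\<close>

lemma eventually_generated_filter:
  assumes "filter_base B"
  shows "eventually P (generated_filter B) \<longleftrightarrow> (\<exists>A\<in>B. \<forall>y\<in>A. P y)"
proof -
  have "eventually P (generated_filter B) \<longleftrightarrow> (\<exists>A\<in>B. eventually P (principal A))"
    using assms unfolding generated_filter_def filter_base_def
    by (intro eventually_INF_base) auto
  then show ?thesis by (simp add: eventually_principal)
qed

lemma generated_filter_neq_bot: "filter_base B \<Longrightarrow> generated_filter B \<noteq> bot"
  unfolding trivial_limit_def by (auto simp: eventually_generated_filter filter_base_def)


section \<open>Filters generated by order intervals\<close>

text \<open>The test filter of the proof: applying a local basis at 0 to it reveals information
  about \<open>D\<close>. Its members contain finite intersections of intervals [-d, d], as
  \<open>D\<close> may fail to be directed.\<close>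

definition interval_filter :: "'a::vector_lattice set \<Rightarrow> 'a filter" where
  "interval_filter D = (INF d\<in>D. principal {y. \<bar>y\<bar> \<le> d})"

lemma eventually_interval_filter:
  "eventually P (interval_filter D) \<longleftrightarrow>
    (\<exists>E\<subseteq>D. finite E \<and> (\<forall>y. (\<forall>d\<in>E. \<bar>y\<bar> \<le> d) \<longrightarrow> P y))"
proof -
  have "eventually P (INF d\<in>E. principal {y. \<bar>y\<bar> \<le> d}) \<longleftrightarrow> (\<forall>y. (\<forall>d\<in>E. \<bar>y\<bar> \<le> d) \<longrightarrow> P y)"
    if "finite E" for E
    using that by (auto simp: INF_principal_finite eventually_principal)
  then show ?thesis
    unfolding interval_filter_def by (subst eventually_INF) blast
qed

text \<open>Finitely many intervals of a decreasing sequence all contain the interval of any larger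
  index.\<close>

lemma eventually_interval_filter_decseq:
  assumes "decseq s"
  shows "eventually P (interval_filter (range s)) \<longleftrightarrow> (\<exists>n. \<forall>y. \<bar>y\<bar> \<le> s n \<longrightarrow> P y)"
  unfolding eventually_interval_filter
proof
  assume "\<exists>E\<subseteq>range s. finite E \<and> (\<forall>y. (\<forall>d\<in>E. \<bar>y\<bar> \<le> d) \<longrightarrow> P y)"
  then obtain K where K: "finite K" "\<And>y. (\<And>k. k \<in> K \<Longrightarrow> \<bar>y\<bar> \<le> s k) \<Longrightarrow> P y"
    by (auto dest!: finite_subset_image[rotated 1])
  obtain n where "\<And>k. k \<in> K \<Longrightarrow> k \<le> n"
    using K(1) Max_ge by blast
  then have "\<forall>y. \<bar>y\<bar> \<le> s n \<longrightarrow> P y"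
    using K(2) decseqD[OF assms] order_trans by blast
  then show "\<exists>n. \<forall>y. \<bar>y\<bar> \<le> s n \<longrightarrow> P y" ..
next
  assume "\<exists>n. \<forall>y. \<bar>y\<bar> \<le> s n \<longrightarrow> P y"
  then obtain n where "\<forall>y. \<bar>y\<bar> \<le> s n \<longrightarrow> P y" ..
  then show "\<exists>E\<subseteq>range s. finite E \<and> (\<forall>y. (\<forall>d\<in>E. \<bar>y\<bar> \<le> d) \<longrightarrow> P y)"
    by (intro exI[of _ "{s n}"]) auto
qed

lemma interval_filter_neq_bot:
  assumes "\<And>d. d \<in> D \<Longrightarrow> 0 \<le> d"
  shows "interval_filter D \<noteq> bot"
  unfolding trivial_limit_def eventually_interval_filter
  using assms by (auto intro!: exI[of _ 0])

lemma subset_eventual_bounds_interval_filter: "D \<subseteq> eventual_bounds (interval_filter D) 0"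
  unfolding eventual_bounds_def eventually_interval_filter
  by (auto intro!: exI[of _ "{_}"])

text \<open>The members of \<open>D\<close> are themselves eventual bounds of the filter that they
  generate.\<close>

lemma interval_filter_converges:
  assumes "isGlb UNIV D 0"
  shows "filter_converges order_converges (interval_filter D) 0"
    and "countable D \<Longrightarrow> filter_converges sigma_order_converges (interval_filter D) 0"
proof -
  have bot: "interval_filter D \<noteq> bot"
    by (rule interval_filter_neq_bot) (rule isGlbD2[OF assms])
  note sub = subset_eventual_bounds_interval_filter[of D]
  have "isGlb UNIV (eventual_bounds (interval_filter D) 0) 0"
    using sub bot by (intro isGlb_zero_coinitial[OF assms]) (auto intro: eventual_bounds_nonneg)
  then show "filter_converges order_converges (interval_filter D) 0"
    unfolding filter_converges_order_iff using bot by blast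
  show "filter_converges sigma_order_converges (interval_filter D) 0" if "countable D"
    unfolding filter_converges_sigma_order_iff using that bot sub assms by blast
qed


section \<open>Strong first countability in terms of sequences\<close>

definition countable_domination :: "'a::vector_lattice itself \<Rightarrow> bool" where
  "countable_domination _ \<longleftrightarrow>
     (\<exists>C::'a set. countable C \<and> (\<forall>c\<in>C. 0 \<le> c) \<and>
        (\<forall>x::nat \<Rightarrow> 'a. decseq x \<and> isGlb UNIV (range x) 0 \<longrightarrow>
          (\<exists>D\<subseteq>C. isGlb UNIV D 0 \<and> (\<forall>d\<in>D. \<exists>n. x n \<le> d))))"

text \<open>Each member \<open>A\<close> of the base obtained for \<open>D\<close> contains a finite
  intersection of intervals with bounds in \<open>E A\<close>. The countably many finite sets
  \<open>E A\<close> together form the required subset of \<open>D\<close>.\<close>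

lemma order_strongly_first_countable_imp_countable_sup_property:
  assumes "order_strongly_first_countable TYPE('a::vector_lattice)"
  shows "countable_sup_property TYPE('a)"
  unfolding countable_sup_property_def
proof (intro allI impI)
  fix D :: "'a set" assume D: "isGlb UNIV D 0"
  obtain H :: "'a set set" where H: "countable H"
    "\<And>F. filter_converges order_converges F 0 \<Longrightarrow> \<exists>B. filter_base B \<and>
      B \<subseteq> {A \<in> H. eventually (\<lambda>y. y \<in> A) F} \<and>
      filter_converges order_converges (generated_filter B) 0"
    using assms unfolding order_strongly_first_countable_def strongly_first_countable_def by meson
  from H(2)[OF interval_filter_converges(1)[OF D]]
  obtain B where B: "filter_base B" "B \<subseteq> H"
    and ev: "\<And>A. A \<in> B \<Longrightarrow> eventually (\<lambda>y. y \<in> A) (interval_filter D)"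
    and conv: "isGlb UNIV (eventual_bounds (generated_filter B) 0) 0"
    unfolding filter_converges_order_iff by auto
  obtain E where E: "\<And>A. A \<in> B \<Longrightarrow> E A \<subseteq> D \<and> finite (E A) \<and>
      (\<forall>y. (\<forall>d\<in>E A. \<bar>y\<bar> \<le> d) \<longrightarrow> y \<in> A)"
    using ev unfolding eventually_interval_filter by metis
  define S where "S = (\<Union>A\<in>B. E A)"
  have "isGlb UNIV S 0"
  proof (rule isGlb_zeroI)
    show "0 \<le> s" if "s \<in> S" for s
      using that E isGlbD2[OF D] by (auto simp: S_def)
  next
    \<comment> \<open>For nonnegative \<open>l\<close> the bound l \<le> d places \<open>l\<close>
      in [-d, d]. Hence \<open>l\<close> is a point of every \<open>A\<close> and lies below every
      eventual bound of the generated filter.\<close>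
    fix l assume l: "0 \<le> l" "\<And>s. s \<in> S \<Longrightarrow> l \<le> s"
    have "l \<in> A" if A: "A \<in> B" for A
    proof -
      have "\<forall>d\<in>E A. \<bar>l\<bar> \<le> d" using A l by (auto simp: S_def)
      then show ?thesis using E[OF A] by blast
    qed
    then have "l \<le> d" if "d \<in> eventual_bounds (generated_filter B) 0" for d
      using that abs_of_nonneg[OF l(1)]
      by (force simp: eventual_bounds_def eventually_generated_filter[OF B(1)])
    then show "l \<le> 0" by (rule isGlb_greatest[OF conv])
  qed
  moreover have "countable S"
    unfolding S_def
    by (rule countable_UN[OF countable_subset[OF B(2) H(1)]]) (simp add: E countable_finite)
  moreover have "S \<subseteq> D" using E by (auto simp: S_def)
  ultimately show "\<exists>S\<subseteq>D. countable S \<and> isGlb UNIV S 0" by blast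
qed

text \<open>The countable set consists of one interpolating \<open>u\<close> for each pair of members of the countable
  local basis with \<open>A \<subseteq> [-u, u] \<subseteq> A'\<close>. Such pairs exist in abundance, because the bounds of the base
  provided for \<open>(x n)\<close> define a convergent filter, to which the local basis applies once more.\<close>

lemma sigma_order_strongly_first_countable_imp_countable_domination:
  assumes "sigma_order_strongly_first_countable TYPE('a::vector_lattice)"
  shows "countable_domination TYPE('a)"
proof -
  obtain H :: "'a set set" where H: "countable H"
    "\<And>F. filter_converges sigma_order_converges F 0 \<Longrightarrow> \<exists>B. filter_base B \<and>
      B \<subseteq> {A \<in> H. eventually (\<lambda>y. y \<in> A) F} \<and>
      filter_converges sigma_order_converges (generated_filter B) 0"
    using assms unfolding sigma_order_strongly_first_countable_def strongly_first_countable_def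
    by meson
  \<comment> \<open>\<open>B\<close> is squeezed between two sequences decreasing to 0: each member
    contains some [-s n, s n], and each [-e k, e k] contains a member.\<close>
  have base: "\<exists>B e. B \<subseteq> H \<and> decseq e \<and> isGlb UNIV (range e) 0 \<and>
      (\<forall>A\<in>B. \<exists>n. \<forall>y. \<bar>y\<bar> \<le> s n \<longrightarrow> y \<in> A) \<and> (\<forall>k::nat. \<exists>A\<in>B. \<forall>y\<in>A. \<bar>y\<bar> \<le> e k)"
    if s: "decseq s" "isGlb UNIV (range s) 0" for s :: "nat \<Rightarrow> 'a"
  proof -
    from H(2)[OF interval_filter_converges(2)[OF s(2)]]
    obtain B where B: "filter_base B" "B \<subseteq> H"
      and ev: "\<forall>A\<in>B. eventually (\<lambda>y. y \<in> A) (interval_filter (range s))"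
      and conv: "filter_converges sigma_order_converges (generated_filter B) 0"
      by auto
    then obtain D where D: "countable D" "D \<subseteq> eventual_bounds (generated_filter B) 0"
      "isGlb UNIV D 0"
      unfolding filter_converges_sigma_order_iff by blast
    have nonneg: "0 \<le> d" if "d \<in> eventual_bounds (generated_filter B) 0" for d
      using that generated_filter_neq_bot[OF B(1)] by (rule eventual_bounds_nonneg[rotated])
    have "isGlb UNIV (eventual_bounds (generated_filter B) 0) 0"
      using D(2) nonneg by (intro isGlb_zero_coinitial[OF D(3)]) auto
    then have "eventual_bounds (generated_filter B) 0 \<noteq> {}" by (rule eventual_bounds_nonempty)
    from countable_coinitial_decseq[OF D(1,2) this inf_eventual_bounds]
    obtain e :: "nat \<Rightarrow> 'a" where e: "decseq e"
      "range e \<subseteq> eventual_bounds (generated_filter B) 0" "\<forall>a\<in>D. \<exists>n. e n \<le> a"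
      by blast
    have "isGlb UNIV (range e) 0"
      using e nonneg by (intro isGlb_zero_coinitial[OF D(3)]) auto
    moreover have "\<exists>A\<in>B. \<forall>y\<in>A. \<bar>y\<bar> \<le> e k" for k
      using e(2) by (auto simp: eventual_bounds_def eventually_generated_filter[OF B(1)])
    ultimately show ?thesis
      using B ev e(1) unfolding eventually_interval_filter_decseq[OF s(1)] by blast
  qed
  define between where "between A A' u \<longleftrightarrow> 0 \<le> u \<and> (\<forall>y\<in>A. \<bar>y\<bar> \<le> u) \<and> (\<forall>y. \<bar>y\<bar> \<le> u \<longrightarrow> y \<in> A')"
    for A A' and u :: 'a
  \<comment> \<open>The choice depends on the pair of basis members alone. This makes
    \<open>C\<close> countable, although the interpolating elements come from arbitrary
    sequences.\<close>
  define c where "c p = (SOME u. between (fst p) (snd p) u)" for p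
  have c: "between A A' (c (A, A'))" if "between A A' u" for A A' u
    unfolding c_def fst_conv snd_conv using that by (rule someI)
  define C where "C = c ` {(A, A') \<in> H \<times> H. \<exists>u. between A A' u}"
  have dom: "\<exists>D\<subseteq>C. isGlb UNIV D 0 \<and> (\<forall>d\<in>D. \<exists>n. x n \<le> d)"
    if x: "decseq x" "isGlb UNIV (range x) 0" for x :: "nat \<Rightarrow> 'a"
  proof -
    have x0: "0 \<le> x n" for n using isGlbD2[OF x(2)] by blast
    obtain B and e :: "nat \<Rightarrow> 'a" where B: "B \<subseteq> H" "\<forall>A\<in>B. \<exists>n. \<forall>y. \<bar>y\<bar> \<le> x n \<longrightarrow> y \<in> A"
      and e: "decseq e" "isGlb UNIV (range e) 0" "\<forall>k. \<exists>A\<in>B. \<forall>y\<in>A. \<bar>y\<bar> \<le> e k"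
      using base[OF x] by metis
    \<comment> \<open>A second application of \<open>base\<close>, now to \<open>e\<close>, nests
      the sets: for suitable indices, [-x n, x n] is inside A, A inside [-e i, e i], this interval
      inside A', and A' inside [-e' k, e' k].\<close>
    obtain B' and e' :: "nat \<Rightarrow> 'a" where B': "B' \<subseteq> H" "\<forall>A\<in>B'. \<exists>n. \<forall>y. \<bar>y\<bar> \<le> e n \<longrightarrow> y \<in> A"
      and e': "isGlb UNIV (range e') 0" "\<forall>k. \<exists>A\<in>B'. \<forall>y\<in>A. \<bar>y\<bar> \<le> e' k"
      using base[OF e(1,2)] by metis
    define D where "D = c ` {(A, A') \<in> B \<times> B'. \<exists>u. between A A' u}"
    have DE: "\<exists>A\<in>B. \<exists>A'\<in>B'. between A A' d" if "d \<in> D" for d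
      using that c unfolding D_def by blast
    have "D \<subseteq> C" using B(1) B'(1) unfolding D_def C_def by blast
    moreover have "\<exists>n. x n \<le> d" if d: "d \<in> D" for d
    proof -
      obtain A A' where A: "A \<in> B" "between A A' d"
        using DE[OF d] by blast
      obtain n where "\<forall>y. \<bar>y\<bar> \<le> x n \<longrightarrow> y \<in> A" using B(2) A(1) by blast
      then have "x n \<in> A" using x0 by simp
      then have "x n \<le> d" using A(2) x0 by (auto simp: between_def)
      then show ?thesis ..
    qed
    moreover have "isGlb UNIV D 0"
    proof (rule isGlb_zero_coinitial[OF e'(1)])
      show "0 \<le> d" if "d \<in> D" for d
        using DE[OF that] by (auto simp: between_def)
    next
      fix a assume "a \<in> range e'"
      then obtain A' where A': "A' \<in> B'" "\<forall>y\<in>A'. \<bar>y\<bar> \<le> a" using e'(2) by blast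
      obtain n where n: "\<forall>y. \<bar>y\<bar> \<le> e n \<longrightarrow> y \<in> A'" using B'(2) A'(1) by blast
      obtain A where A: "A \<in> B" "\<forall>y\<in>A. \<bar>y\<bar> \<le> e n" using e(3) by blast
      \<comment> \<open>The bound \<open>e n\<close> shows that the pair is admissible. The selected
        \<open>c (A, A')\<close> may be another element, but it lies in \<open>A'\<close> and so
        below \<open>a\<close>.\<close>
      have ex: "between A A' (e n)" using A n isGlbD2[OF e(2)] by (simp add: between_def)
      then have "c (A, A') \<in> D" using A(1) A'(1) unfolding D_def by blast
      moreover have "c (A, A') \<le> a"
      proof -
        have "0 \<le> c (A, A')" "c (A, A') \<in> A'" using c[OF ex] by (simp_all add: between_def)
        then show ?thesis using A'(2) by fastforce
      qed
      ultimately show "\<exists>d\<in>D. d \<le> a" by blast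
    qed
    ultimately show ?thesis by blast
  qed
  have "countable C"
    unfolding C_def
    by (rule countable_image, rule countable_subset[of _ "H \<times> H"]) (use H(1) in auto)
  moreover have "0 \<le> u" if u: "u \<in> C" for u
  proof -
    obtain A A' where "between A A' u" using u c unfolding C_def by blast
    then show ?thesis by (simp add: between_def)
  qed
  ultimately show ?thesis
    unfolding countable_domination_def
    by (intro exI[of _ C]) (simp add: dom)
qed

text \<open>For a convergent filter the countable supremum property provides a decreasing sequence
  of eventual bounds. The elements of \<open>C\<close> above terms of it are again eventual bounds,
  so their intervals around \<open>x\<close> belong to the filter.\<close>

lemma order_strongly_first_countableI:
  assumes csp: "countable_sup_property TYPE('a::vector_lattice)"
    and "countable_domination TYPE('a)"
  shows "order_strongly_first_countable TYPE('a)"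
  unfolding order_strongly_first_countable_def strongly_first_countable_def
proof
  fix x :: 'a
  obtain C :: "'a set" where C: "countable C" "\<And>c. c \<in> C \<Longrightarrow> 0 \<le> c"
    and dom: "\<And>x::nat \<Rightarrow> 'a. decseq x \<Longrightarrow> isGlb UNIV (range x) 0 \<Longrightarrow>
      \<exists>D\<subseteq>C. isGlb UNIV D 0 \<and> (\<forall>d\<in>D. \<exists>n. x n \<le> d)"
    using assms(2) unfolding countable_domination_def by blast
  define N where "N E = {y. \<forall>c\<in>E. \<bar>y - x\<bar> \<le> c}" for E
  define H where "H = N ` {E. finite E \<and> E \<subseteq> C}"
  have "\<exists>B. filter_base B \<and> B \<subseteq> {A \<in> H. eventually (\<lambda>y. y \<in> A) F} \<and>
      filter_converges order_converges (generated_filter B) x"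
    if F: "filter_converges order_converges F x" for F
  proof -
    have glb: "isGlb UNIV (eventual_bounds F x) 0"
      using F unfolding filter_converges_order_iff by blast
    from countable_sup_property_decseq[OF csp glb eventual_bounds_nonempty[OF glb]
        inf_eventual_bounds]
    obtain s where s: "decseq s" "range s \<subseteq> eventual_bounds F x" "isGlb UNIV (range s) 0" by blast
    obtain D where D: "D \<subseteq> C" "isGlb UNIV D 0" "\<And>d. d \<in> D \<Longrightarrow> \<exists>n. s n \<le> d"
      using dom[OF s(1,3)] by blast
    define B where "B = N ` {E. finite E \<and> E \<subseteq> D}"
    have base: "filter_base B"
      unfolding filter_base_def
    proof (intro conjI ballI)
      show "B \<noteq> {}" by (auto simp: B_def)
      have "x \<in> N E" if "E \<subseteq> D" for E
        using that D(1) C(2) by (auto simp: N_def)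
      then show "{} \<notin> B" by (auto simp: B_def)
    next
      fix A A' assume "A \<in> B" "A' \<in> B"
      then obtain E E' where "finite (E \<union> E')" "E \<union> E' \<subseteq> D" "A = N E" "A' = N E'"
        by (auto simp: B_def)
      moreover have "N (E \<union> E') = N E \<inter> N E'" by (auto simp: N_def)
      ultimately show "\<exists>A''\<in>B. A'' \<subseteq> A \<inter> A'" by (auto simp: B_def)
    qed
    have "eventually (\<lambda>y. y \<in> N E) F" if E: "finite E" "E \<subseteq> D" for E
    proof -
      have "eventually (\<lambda>y. \<bar>y - x\<bar> \<le> c) F" if c: "c \<in> E" for c
      proof -
        obtain n where n: "s n \<le> c" using D(3) E(2) c by blast
        have "eventually (\<lambda>y. \<bar>y - x\<bar> \<le> s n) F" using s(2) by (auto simp: eventual_bounds_def)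
        then show ?thesis by (rule eventually_mono) (use n in \<open>auto intro: order_trans\<close>)
      qed
      then show ?thesis using E(1) by (simp add: N_def eventually_ball_finite_distrib)
    qed
    then have "B \<subseteq> {A \<in> H. eventually (\<lambda>y. y \<in> A) F}"
      using D(1) by (auto simp: B_def H_def)
    moreover have "filter_converges order_converges (generated_filter B) x"
      unfolding filter_converges_order_iff
    proof
      show bot: "generated_filter B \<noteq> bot" by (rule generated_filter_neq_bot[OF base])
      have "D \<subseteq> eventual_bounds (generated_filter B) x"
      proof
        fix d assume "d \<in> D"
        then have "N {d} \<in> B" by (auto simp: B_def)
        then show "d \<in> eventual_bounds (generated_filter B) x"
          unfolding eventual_bounds_def eventually_generated_filter[OF base] mem_Collect_eq
          by (rule bexI[rotated]) (simp add: N_def)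
      qed
      then show "isGlb UNIV (eventual_bounds (generated_filter B) x) 0"
        using bot by (intro isGlb_zero_coinitial[OF D(2)]) (auto intro: eventual_bounds_nonneg)
    qed
    ultimately show ?thesis using base by blast
  qed
  moreover have "countable H"
    unfolding H_def using C(1) by (intro countable_image countable_Collect_finite_subset)
  ultimately show "\<exists>H. countable H \<and> (\<forall>F. filter_converges order_converges F x \<longrightarrow>
      (\<exists>B. filter_base B \<and> B \<subseteq> {A \<in> H. eventually (\<lambda>y. y \<in> A) F} \<and>
        filter_converges order_converges (generated_filter B) x))"
    by blast
qed

text \<open>The assumption implies the countable supremum property, under which both notions of
  filter convergence agree.\<close>

lemma order_strongly_first_countable_imp_sigma:
  assumes "order_strongly_first_countable TYPE('a::vector_lattice)"
  shows "sigma_order_strongly_first_countable TYPE('a)"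
  using assms filter_converges_order_eq_sigma[where 'a = 'a]
    order_strongly_first_countable_imp_countable_sup_property[OF assms]
  by (simp add: order_strongly_first_countable_def sigma_order_strongly_first_countable_def)

text \<open>Neither condition on the right mentions filters, which makes the comparison with the
  completion possible.\<close>

lemma order_strongly_first_countable_iff:
  "order_strongly_first_countable TYPE('a::vector_lattice) \<longleftrightarrow>
    countable_sup_property TYPE('a) \<and> countable_domination TYPE('a)"
  using order_strongly_first_countable_imp_countable_sup_property[where 'a = 'a]
    order_strongly_first_countable_imp_sigma[where 'a = 'a]
    sigma_order_strongly_first_countable_imp_countable_domination[where 'a = 'a]
    order_strongly_first_countableI[where 'a = 'a]
  by blast


section \<open>Almost \<open>\<sigma>\<close>-order completeness\<close>

text \<open>In the overlattice the \<open>s n\<close> have an infimum \<open>t\<close>, and super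
  order density makes \<open>t\<close> a supremum of elements \<open>y m\<close> of the space. The
  conclusion records this inside the space, where \<open>t\<close> may be missing.\<close>

lemma almost_sigma_order_complete_approximation:
  fixes s :: "nat \<Rightarrow> 'a::vector_lattice"
  assumes "almost_sigma_order_complete TYPE('a)" and s0: "\<And>n. 0 \<le> s n"
  shows "\<exists>y::nat \<Rightarrow> 'a. (\<forall>m n. y m \<le> s n) \<and> isGlb UNIV {s n - y m |n m. True} 0"
proof -
  obtain j :: "'a \<Rightarrow> nat \<Rightarrow> 'a" and Z add zero scale le
    where V: "vector_lattice_on Z add zero scale le"
    and S: "sigma_order_complete_on Z le"
    and E: "super_order_dense_embedding j Z add zero scale le"
    using assms(1) unfolding almost_sigma_order_complete_def by blast
  interpret vector_lattice_on Z add zero scale le by (fact V)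
  have leZ: "le \<subseteq> Z \<times> Z" and anti: "antisym le" and trans: "trans le" and refl: "refl_on Z le"
    using partial_order by (auto dest: partial_order_onD)
  have jZ: "j x \<in> Z" and injj: "inj j" and jadd: "j (x + y) = add (j x) (j y)"
    and jsup: "lub_on Z le {j x, j y} (j (sup x y))" for x y
    using E by (auto simp: super_order_dense_embedding_def)
  note closed = jZ add_closed zero_closed
  have zero_add: "add zero x = x" if "x \<in> Z" for x
    using that by (simp add: add_commute[OF zero_closed] add_zero)
  have j0: "j 0 = zero"
  proof -
    obtain w where w: "w \<in> Z" "add (j 0) w = zero" using add_inverse jZ by blast
    have "j 0 = add (add (j 0) (j 0)) w"
      by (simp add: add_assoc w closed add_zero)
    also have "add (j 0) (j 0) = j 0" by (simp flip: jadd)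
    finally show ?thesis using w by simp
  qed
  have jmono: "(j x, j y) \<in> le \<longleftrightarrow> x \<le> y" for x y
  proof
    assume "x \<le> y"
    then show "(j x, j y) \<in> le" using jsup[of x y] by (simp add: sup_absorb2 lub_on_def)
  next
    assume "(j x, j y) \<in> le"
    then have "(j (sup x y), j y) \<in> le"
      using jsup[of x y] refl jZ by (auto simp: lub_on_def refl_on_def)
    moreover have "(j y, j (sup x y)) \<in> le" using jsup[of x y] by (simp add: lub_on_def)
    ultimately have "sup x y = y" using anti injj by (auto dest: antisymD injD)
    then show "x \<le> y" by (simp add: le_iff_sup)
  qed
  \<comment> \<open>Completeness is given for suprema: \<open>w\<close> is the supremum of the
    differences s 0 - s n, which are bounded by s 0, and t = s 0 - w takes the role of the
    infimum.\<close>
  have "range (\<lambda>n. j (s 0 - s n)) \<subseteq> Z" using jZ by blast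
  moreover have "\<exists>t\<in>Z. \<forall>a\<in>range (\<lambda>n. j (s 0 - s n)). (a, t) \<in> le"
    by (rule bexI[of _ "j (s 0)"]) (simp_all add: jmono s0 jZ)
  ultimately have "\<exists>w. lub_on Z le (range (\<lambda>n. j (s 0 - s n))) w"
    using S unfolding sigma_order_complete_on_def by simp
  then obtain w where w: "w \<in> Z" "\<And>n. (j (s 0 - s n), w) \<in> le"
    and w_least: "\<And>t. t \<in> Z \<Longrightarrow> (\<And>n. (j (s 0 - s n), t) \<in> le) \<Longrightarrow> (w, t) \<in> le"
    unfolding lub_on_def by auto
  obtain w' where w': "w' \<in> Z" "add w w' = zero" using add_inverse w(1) by blast
  define t where "t = add (j (s 0)) w'"
  have tZ: "t \<in> Z" using closed w' by (simp add: t_def)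
  have below: "(j a, t) \<in> le" if a: "\<And>n. a \<le> s n" for a
  proof -
    have "(w, j (s 0 - a)) \<in> le" using a by (intro w_least) (auto simp: jZ jmono)
    from add_mono[OF add_mono[OF this w'(1)] jZ]
    have "(add zero (j a), add (add (j (s 0 - a)) w') (j a)) \<in> le" by (simp add: w')
    also have "add (add (j (s 0 - a)) w') (j a) = add (add (j (s 0 - a)) (j a)) w'"
      using closed w' by (simp add: add_assoc add_commute[of w' "j a"])
    also have "\<dots> = t" by (simp add: t_def flip: jadd)
    finally show ?thesis using closed by (simp add: zero_add)
  qed
  have above: "(t, j (s n)) \<in> le" for n
  proof -
    from add_mono[OF add_mono[OF w(2)[of n] jZ] w'(1)]
    have "(add (add (j (s 0 - s n)) (j (s n))) w', add (add w (j (s n))) w') \<in> le" .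
    also have "add (add w (j (s n))) w' = add (add w w') (j (s n))"
      using closed w w'(1) by (simp add: add_assoc add_commute[of w' "j (s n)"])
    finally show ?thesis using closed by (simp add: t_def w' zero_add flip: jadd)
  qed
  have "\<exists>y::nat \<Rightarrow> 'a. lub_on Z le (range (\<lambda>n. j (y n))) t"
  proof (cases "t = zero")
    case True
    have "lub_on Z le (range (\<lambda>n::nat. j 0)) t"
      using tZ refl by (auto simp: True j0 lub_on_def refl_on_def)
    then show ?thesis by (intro exI[of _ "\<lambda>_. 0"]) simp
  next
    case False
    have "(zero, t) \<in> le" using below[of 0] s0 by (simp add: j0)
    with False tZ E show ?thesis unfolding super_order_dense_embedding_def by blast
  qed
  then obtain y :: "nat \<Rightarrow> 'a" where y: "\<And>m. (j (y m), t) \<in> le"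
    and y_least: "\<And>u. u \<in> Z \<Longrightarrow> (\<And>m. (j (y m), u) \<in> le) \<Longrightarrow> (t, u) \<in> le"
    unfolding lub_on_def by auto
  have ys: "y m \<le> s n" for m n
    using transD[OF trans y above] by (simp add: jmono)
  moreover have "isGlb UNIV {s n - y m |n m. True} 0"
  proof (rule isGlb_zeroI)
    show "0 \<le> a" if "a \<in> {s n - y m |n m. True}" for a
      using that ys by auto
  next
    fix l assume l: "\<And>a. a \<in> {s n - y m |n m. True} \<Longrightarrow> l \<le> a"
    \<comment> \<open>If \<open>l\<close> is below all differences, then y m + l is below every
      \<open>s n\<close>, hence below \<open>t\<close>. So t - l bounds all \<open>y m\<close>, and
      t \<le> t - l forces l \<le> 0.\<close>
    have "(t, add t (j (- l))) \<in> le"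
    proof (rule y_least)
      fix m
      have "y m + l \<le> s n" for n
        using l[of "s n - y m"] by (auto simp: algebra_simps)
      from add_mono[OF below[OF this] jZ, of "- l"]
      show "(j (y m), add t (j (- l))) \<in> le" by (simp flip: jadd)
    qed (use tZ closed in simp)
    moreover obtain t' where t': "t' \<in> Z" "add t t' = zero" using add_inverse tZ by blast
    ultimately have "(zero, add (add t (j (- l))) t') \<in> le"
      using add_mono by fastforce
    also have "add (add t (j (- l))) t' = add (add t t') (j (- l))"
      using closed tZ t'(1) by (simp add: add_assoc add_commute[of t' "j (- l)"])
    finally have "(j 0, j (- l)) \<in> le" by (simp add: t' zero_add closed j0)
    then show "l \<le> 0" by (simp add: jmono)
  qed
  ultimately show ?thesis by blast
qed

text \<open>In a decreasing sequence taken from \<open>T\<close>, each \<open>c\<close> is treated infinitely often by the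
  dichotomy \<open>step\<close>. If \<open>c\<close> dominates a tail of the sequence up to its infimum, the second alternative is
  excluded, so that the infimum exceeds no element of \<open>T\<close> by more than \<open>c\<close>.\<close>

lemma countable_sup_propertyI:
  assumes asc: "almost_sigma_order_complete TYPE('a::vector_lattice)"
    and "countable_domination TYPE('a)"
  shows "countable_sup_property TYPE('a)"
  unfolding countable_sup_property_def
proof (intro allI impI)
  fix A :: "'a set" assume A: "isGlb UNIV A 0"
  obtain C :: "'a set" where C: "countable C"
    and dom: "\<And>x::nat \<Rightarrow> 'a. decseq x \<Longrightarrow> isGlb UNIV (range x) 0 \<Longrightarrow>
      \<exists>D\<subseteq>C. isGlb UNIV D 0 \<and> (\<forall>d\<in>D. \<exists>n. x n \<le> d)"
    using assms(2) unfolding countable_domination_def by blast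
  show "\<exists>B\<subseteq>A. countable B \<and> isGlb UNIV B 0"
  proof (cases "A = {}")
    case True
    with A show ?thesis by blast
  next
    case False
    \<comment> \<open>Closes \<open>A\<close> under infima of two elements while remembering finite
      subsets, from which a countable subset of \<open>A\<close> is recovered at the end.\<close>
    define T where "T = {t. \<exists>E\<subseteq>A. finite E \<and> isGlb UNIV E t}"
    have AT: "A \<subseteq> T"
    proof
      fix a assume "a \<in> A"
      moreover have "isGlb UNIV {a} a" by (rule isGlbI) auto
      ultimately show "a \<in> T" unfolding T_def by (intro CollectI exI[of _ "{a}"]) auto
    qed
    have infT: "inf a b \<in> T" if ab: "a \<in> T" "b \<in> T" for a b
    proof -
      obtain E E' where E: "E \<union> E' \<subseteq> A" "finite (E \<union> E')" "isGlb UNIV E a" "isGlb UNIV E' b"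
        using ab unfolding T_def by blast
      have "isGlb UNIV (E \<union> E') (inf a b)"
        using isGlbD2[OF E(3)] isGlbD2[OF E(4)]
        by (intro isGlbI) (auto intro: le_infI1 le_infI2 isGlb_greatest[OF E(3)] isGlb_greatest[OF E(4)])
      with E show ?thesis unfolding T_def by blast
    qed
    have T0: "0 \<le> t" if "t \<in> T" for t
      using that isGlbD2[OF A] by (auto simp: T_def intro: isGlb_greatest)
    have glbT: "l \<le> 0" if "\<And>t. t \<in> T \<Longrightarrow> l \<le> t" for l
      using that AT by (intro isGlb_greatest[OF A]) auto
    have step: "\<exists>s'\<in>T. s' \<le> s \<and> ((\<forall>a\<in>T. s' - a \<le> c) \<or> \<not> s - s' \<le> c)" if s: "s \<in> T" for s c
    proof (cases "\<exists>g\<in>T. \<forall>a\<in>T. g - a \<le> c")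
      case True
      then obtain g where g: "g \<in> T" "\<And>a. a \<in> T \<Longrightarrow> g - a \<le> c" by blast
      have "inf s g - a \<le> c" if "a \<in> T" for a
        by (rule order_trans[OF _ g(2)[OF that]]) (simp add: diff_right_mono)
      then show ?thesis using infT[OF s g(1)] by (intro bexI[of _ "inf s g"]) auto
    next
      case False
      \<comment> \<open>The failure at every element of \<open>T\<close> is applied to
        \<open>s\<close> itself.\<close>
      then obtain a where a: "a \<in> T" "\<not> s - a \<le> c" using s by blast
      have "s - a \<le> s - inf s a" by (simp add: diff_left_mono)
      with a(2) have "\<not> s - inf s a \<le> c" using order_trans by blast
      then show ?thesis using infT[OF s a(1)] by (intro bexI[of _ "inf s a"]) auto
    qed
    \<comment> \<open>Decoding pairs makes each \<open>c\<close> occur beyond any given index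
      \<open>n\<close>, since prod_encode (i, n) is at least \<open>n\<close>. The inserted 0 guards
      against empty \<open>C\<close>.\<close>
    define e where "e n = from_nat_into (insert 0 C) (fst (prod_decode n))" for n
    have "\<exists>s. \<forall>n. s n \<in> T \<and> (s (Suc n) \<le> s n \<and>
        ((\<forall>a\<in>T. s (Suc n) - a \<le> e n) \<or> \<not> s n - s (Suc n) \<le> e n))"
    proof (rule dependent_nat_choice)
      show "\<exists>t. t \<in> T" using AT False by blast
      show "\<exists>s'. s' \<in> T \<and> (s' \<le> t \<and> ((\<forall>a\<in>T. s' - a \<le> e n) \<or> \<not> t - s' \<le> e n))"
        if "t \<in> T" for t n
        using step[OF that] by blast
    qed
    then obtain s where s: "\<And>n. s n \<in> T" "\<And>n. s (Suc n) \<le> s n"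
      "\<And>n. (\<forall>a\<in>T. s (Suc n) - a \<le> e n) \<or> \<not> s n - s (Suc n) \<le> e n"
      by metis
    have dec: "decseq s" using s(2) by (rule decseq_SucI)
    obtain y :: "nat \<Rightarrow> 'a" where y: "\<And>m n. y m \<le> s n" "isGlb UNIV {s n - y m |n m. True} 0"
      using almost_sigma_order_complete_approximation[OF asc, of s] T0 s(1) by blast
    \<comment> \<open>\<open>dom\<close> asks for a decreasing sequence, so the differences are
      enlarged to an inf-closed set. Closure holds because \<open>s\<close> decreases and its lower
      bounds are closed under \<open>sup\<close>.\<close>
    define W where "W = {w. \<exists>n u. s n - u \<le> w \<and> (\<forall>m. u \<le> s m)}"
    have sub: "{s n - y m |n m. True} \<subseteq> W" using y(1) by (auto simp: W_def)
    have W0: "0 \<le> w" if "w \<in> W" for w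
      using that by (auto simp: W_def intro: order_trans[rotated])
    have infW: "inf a b \<in> W" if ab: "a \<in> W" "b \<in> W" for a b
    proof -
      obtain n u n' u' where *: "s n - u \<le> a" "s n' - u' \<le> b" "\<And>m. u \<le> s m" "\<And>m. u' \<le> s m"
        using ab unfolding W_def by blast
      have "s (max n n') - sup u u' \<le> s n - u" "s (max n n') - sup u u' \<le> s n' - u'"
        by (rule diff_mono; simp add: decseqD[OF dec])+
      with *(1,2) have "s (max n n') - sup u u' \<le> inf a b" by (meson le_inf_iff order_trans)
      moreover have "\<forall>m. sup u u' \<le> s m" using *(3,4) by simp
      ultimately show ?thesis unfolding W_def by blast
    qed
    have "countable {s n - y m |n m. True}"
    proof -
      have "{s n - y m |n m. True} = range (\<lambda>(n, m). s n - y m)" by auto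
      then show ?thesis by simp
    qed
    from countable_coinitial_decseq[OF this sub _ infW] sub
    obtain x :: "nat \<Rightarrow> 'a" where x: "decseq x" "range x \<subseteq> W"
      "\<forall>a\<in>{s n - y m |n m. True}. \<exists>k. x k \<le> a"
      by blast
    have "isGlb UNIV (range x) 0"
      using x(2,3) W0 by (intro isGlb_zero_coinitial[OF y(2)]) blast+
    from dom[OF x(1) this] obtain D where D: "D \<subseteq> C" "isGlb UNIV D 0"
      and xD: "\<And>d. d \<in> D \<Longrightarrow> \<exists>k. x k \<le> d" by blast
    have near: "y k - a \<le> d" if d: "d \<in> D" and a: "a \<in> T" for d a k
    proof -
      obtain k' where k': "x k' \<le> d" using xD[OF d] by blast
      have "x k' \<in> W" using x(2) by blast
      then obtain n u where u: "s n - u \<le> x k'" "\<And>m. u \<le> s m" by (auto simp: W_def)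
      obtain i where i: "from_nat_into (insert 0 C) i = d"
        using from_nat_into_surj[of "insert 0 C" d] C D(1) d by auto
      \<comment> \<open>An index in the tail from \<open>n\<close> on at which \<open>d\<close> is
        treated; from there \<open>s\<close> drops by at most s n - u, hence by at most
        \<open>d\<close>.\<close>
      define m where "m = prod_encode (i, n)"
      have m: "n \<le> m" "e m = d" by (simp_all add: m_def e_def i le_prod_encode_2)
      have "s m - s (Suc m) \<le> s n - u"
        using decseqD[OF dec m(1)] u(2) by (intro diff_mono)
      also have "\<dots> \<le> d" using u(1) k' by (rule order_trans)
      finally have "s (Suc m) - a \<le> d" using s(3)[of m] a by (auto simp: m)
      moreover have "y k - a \<le> s (Suc m) - a" using y(1) by (rule diff_right_mono)
      ultimately show ?thesis by (rule order_trans[rotated])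
    qed
    \<comment> \<open>Letting \<open>d\<close> run through \<open>D\<close> makes \<open>y k\<close>
      a lower bound of \<open>T\<close>, hence at most 0. Then s n \<le> s n - y m, so
      \<open>s\<close> has infimum 0 as well.\<close>
    have "y k - a \<le> 0" if "a \<in> T" for a k
      using near that by (intro isGlb_greatest[OF D(2)])
    then have y0: "y k \<le> 0" for k by (intro glbT) (simp add: algebra_simps)
    have glb_s: "isGlb UNIV (range s) 0"
    proof (rule isGlb_zero_coinitial[OF y(2)])
      fix a assume "a \<in> {s n - y m |n m. True}"
      then obtain n m where "a = s n - y m" by blast
      then have "s n \<le> a" using diff_left_mono[OF y0[of m], of "s n"] by simp
      then show "\<exists>b\<in>range s. b \<le> a" by blast
    qed (use T0 s(1) in auto)
    obtain E where E: "\<And>n. E n \<subseteq> A" "\<And>n. finite (E n)" "\<And>n. isGlb UNIV (E n) (s n)"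
      using s(1) unfolding T_def by simp metis
    have "isGlb UNIV (\<Union>n. E n) 0"
    proof (rule isGlb_zeroI)
      show "0 \<le> a" if "a \<in> (\<Union>n. E n)" for a
        using that E(1) isGlbD2[OF A] by blast
      show "l \<le> 0" if l: "\<And>a. a \<in> (\<Union>n. E n) \<Longrightarrow> l \<le> a" for l
      proof (rule isGlb_greatest[OF glb_s])
        fix t assume "t \<in> range s"
        then show "l \<le> t" using l isGlb_greatest[OF E(3)] by blast
      qed
    qed
    moreover have "countable (\<Union>n. E n)" using E(2) by (intro countable_UN) (simp_all add: countable_finite)
    ultimately show ?thesis using E(1) by (intro exI[of _ "\<Union>n. E n"]) blast
  qed
qed

text \<open>The whole type \<open>'b\<close> serves as the carrier. This is applied to the Dedekind
  completion and, with the identity map, to a Dedekind complete space itself.\<close>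

lemma almost_sigma_order_complete_if_super_order_dense:
  fixes j :: "'a::vector_lattice \<Rightarrow> 'b::dedekind_complete_vector_lattice"
  assumes lin: "linear j" and "inj j" and jsup: "\<And>x y. j (sup x y) = sup (j x) (j y)"
    and dense: "\<And>z. 0 < z \<Longrightarrow> \<exists>y::nat \<Rightarrow> 'a. (\<forall>n. 0 \<le> y n) \<and>
      (\<forall>n. j (y n) \<le> z) \<and> (\<forall>t. (\<forall>n. j (y n) \<le> t) \<longrightarrow> z \<le> t)"
  shows "almost_sigma_order_complete TYPE('a)"
proof (rule almost_sigma_order_completeI)
  let ?le = "{(x, y). x \<le> y} :: 'b rel"
  show "vector_lattice_on (UNIV :: 'b set) (+) 0 scaleR ?le"
  proof
    show "partial_order_on UNIV ?le"
      by (auto simp: partial_order_on_def preorder_on_def refl_on_def trans_def antisym_def)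
    show "\<exists>s. lub_on UNIV ?le {x, y} s" for x y
      by (intro exI[of _ "sup x y"]) (simp add: lub_on_def)
    show "\<exists>s. lub_on UNIV (?le\<inverse>) {x, y} s" for x y
      by (intro exI[of _ "inf x y"]) (simp add: lub_on_def)
    show "\<exists>y\<in>UNIV. x + y = 0" for x :: 'b
      by (rule bexI[of _ "- x"]) auto
  qed (auto simp: algebra_simps scaleR_left_mono)
  show "sigma_order_complete_on UNIV ?le"
    unfolding sigma_order_complete_on_def lub_on_def
    by (auto intro!: exI[of _ "Sup _"] cSup_upper cSup_least bdd_aboveI)
  show "super_order_dense_embedding j UNIV (+) 0 scaleR ?le"
    unfolding super_order_dense_embedding_def
    using assms by (auto simp: linear_add linear_scale lub_on_def less_le)
qed

lemma dedekind_complete_imp_almost_sigma_order_complete: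
  "almost_sigma_order_complete TYPE('b::dedekind_complete_vector_lattice)"
proof (rule almost_sigma_order_complete_if_super_order_dense[of id])
  fix z :: 'b assume "0 < z"
  then show "\<exists>y::nat \<Rightarrow> 'b. (\<forall>n. 0 \<le> y n) \<and> (\<forall>n. id (y n) \<le> z) \<and>
      (\<forall>t. (\<forall>n. id (y n) \<le> t) \<longrightarrow> z \<le> t)"
    by (intro exI[of _ "\<lambda>_. z"]) simp
qed (simp_all add: linear_id[unfolded id_def[symmetric]])


section \<open>Passage to the Dedekind completion\<close>

context
  fixes j :: "'a::archimedean_vector_lattice \<Rightarrow> 'b::dedekind_complete_vector_lattice"
  assumes dc: "dedekind_completion j"
begin

section \<open>Elementary properties of the embedding\<close>

lemma linear_completion: "linear j"
  and completion_sup: "j (sup x y) = sup (j x) (j y)"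
  and inj_completion: "inj j"
  and completion_order_dense: "0 < z \<Longrightarrow> \<exists>x. 0 < j x \<and> j x \<le> z"
  and completion_majorizing: "\<exists>x. z \<le> j x"
  using dc unfolding dedekind_completion_def by blast+

lemma completion_le_iff: "j x \<le> j y \<longleftrightarrow> x \<le> y"
  using completion_sup[of x y] inj_completion by (metis injD le_iff_sup)

lemma completion_zero: "j 0 = 0"
  and completion_add: "j (x + y) = j x + j y"
  and completion_diff: "j (x - y) = j x - j y"
  using linear_completion by (auto simp: linear_0 linear_add linear_diff)

lemma completion_inf: "j (inf x y) = inf (j x) (j y)"
  by (simp only: inf_eq_neg_sup completion_sup linear_neg[OF linear_completion])

lemma completion_nonneg_iff: "0 \<le> j x \<longleftrightarrow> 0 \<le> x"
  using completion_le_iff[of 0 x] by (simp add: completion_zero)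

text \<open>If \<open>z - inf z w\<close> were positive, it would dominate some \<open>j x > 0\<close>, and adding \<open>x\<close> repeatedly would
  never leave the order interval \<open>[0, z]\<close>.\<close>

lemma completion_le_if_lower:
  assumes z: "0 \<le> z" and low: "\<And>x. 0 \<le> x \<Longrightarrow> j x \<le> z \<Longrightarrow> j x \<le> w"
  shows "z \<le> w"
proof (rule ccontr)
  assume "\<not> z \<le> w"
  then have "inf z w < z" by (metis inf_le1 le_iff_inf less_le)
  then have "0 < z - inf z w" by (simp only: diff_gt_0_iff_gt)
  then obtain x where x: "0 < j x" "j x \<le> z - inf z w" using completion_order_dense by blast
  have x0: "0 \<le> x" using x(1) completion_nonneg_iff by (simp add: less_le)
  have "j (real n *\<^sub>R x) \<le> z" for n
  proof (induction n)
    case (Suc n)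
    have "0 \<le> real n *\<^sub>R x" using x0 by (simp add: scaleR_nonneg_nonneg)
    \<comment> \<open>By \<open>low\<close> the multiple is below \<open>inf z w\<close> and not
      just below \<open>z\<close>, which leaves room for one more \<open>x\<close>.\<close>
    then have "j (real n *\<^sub>R x) \<le> inf z w" using low Suc by simp
    then have "j (real n *\<^sub>R x) + j x \<le> inf z w + (z - inf z w)" using x(2) by (rule add_mono)
    also have "inf z w + (z - inf z w) = z" by (metis add.commute diff_add_cancel)
    finally show ?case by (simp add: scaleR_left_distrib completion_add add.commute)
  qed (simp add: completion_zero z)
  moreover obtain u where "z \<le> j u" using completion_majorizing by blast
  ultimately have "real n *\<^sub>R x \<le> u" for n
    using order_trans completion_le_iff by blast
  then have "x \<le> 0" by (rule archimedean)
  with x0 x(1) show False by (simp add: completion_zero)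
qed

text \<open>Subtraction from a majorant \<open>u\<close> turns minorants of \<open>j u - z\<close>
  into majorants of \<open>z\<close>, so the criterion by minorants applies.\<close>

lemma completion_le_if_upper:
  assumes upp: "\<And>x. z \<le> j x \<Longrightarrow> w \<le> j x"
  shows "w \<le> z"
proof -
  obtain u where u: "z \<le> j u" using completion_majorizing by blast
  have "j u - z \<le> j u - w"
  proof (rule completion_le_if_lower)
    fix x assume "j x \<le> j u - z"
    then have "w \<le> j (u - x)" by (intro upp) (simp add: completion_diff algebra_simps)
    then show "j x \<le> j u - w" by (simp add: completion_diff algebra_simps)
  qed (use u in simp)
  then show ?thesis by simp
qed

text \<open>A nonnegative lower bound in the completion is controlled by the elements of the space
  below it, and these are lower bounds of \<open>A\<close>.\<close>

lemma isGlb_zero_completion_iff: "isGlb UNIV (j ` A) 0 \<longleftrightarrow> isGlb UNIV A 0"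
proof
  assume A: "isGlb UNIV (j ` A) 0"
  show "isGlb UNIV A 0"
  proof (rule isGlbI)
    show "0 \<le> a" if "a \<in> A" for a
      using isGlbD2[OF A, of "j a"] that by (simp add: completion_nonneg_iff)
    show "l \<le> 0" if l: "\<And>a. a \<in> A \<Longrightarrow> l \<le> a" for l
    proof -
      have "j l \<le> j 0"
        unfolding completion_zero
        by (rule isGlb_greatest[OF A]) (use l in \<open>auto simp: completion_le_iff\<close>)
      then show ?thesis by (simp only: completion_le_iff)
    qed
  qed
next
  assume A: "isGlb UNIV A 0"
  show "isGlb UNIV (j ` A) 0"
  proof (rule isGlb_zeroI)
    show "0 \<le> b" if "b \<in> j ` A" for b
      using isGlbD2[OF A] that by (auto simp: completion_nonneg_iff)
  next
    fix l assume l: "0 \<le> l" "\<And>b. b \<in> j ` A \<Longrightarrow> l \<le> b"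
    show "l \<le> 0"
    proof (rule completion_le_if_lower[OF l(1)])
      fix x assume "j x \<le> l"
      then have "x \<le> a" if "a \<in> A" for a
        using l(2) that completion_le_iff order_trans by blast
      then have "x \<le> 0" by (rule isGlb_greatest[OF A])
      then show "j x \<le> 0" using completion_le_iff[of x 0] by (simp add: completion_zero)
    qed
  qed
qed

text \<open>Carries a set from the completion into the space: each \<open>a\<close> is the infimum
  of the images above it, so majorants keep the infimum 0.\<close>

lemma isGlb_zero_majorants:
  assumes A: "isGlb UNIV A 0"
  shows "isGlb UNIV {u. \<exists>a\<in>A. a \<le> j u} 0"
proof (rule isGlb_zeroI)
  fix u assume "u \<in> {u. \<exists>a\<in>A. a \<le> j u}"
  then have "0 \<le> j u" using isGlbD2[OF A] order_trans by blast
  then show "0 \<le> u" by (simp add: completion_nonneg_iff)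
next
  fix l assume l: "\<And>u. u \<in> {u. \<exists>a\<in>A. a \<le> j u} \<Longrightarrow> l \<le> u"
  have "j l \<le> a" if "a \<in> A" for a
    by (rule completion_le_if_upper) (use l that in \<open>auto simp: completion_le_iff\<close>)
  then have "j l \<le> j 0" unfolding completion_zero by (rule isGlb_greatest[OF A])
  then show "l \<le> 0" by (simp only: completion_le_iff)
qed

section \<open>Countable approximation of elements of the completion\<close>

text \<open>The gaps y - x between elements above and below \<open>z\<close> have infimum 0.
  Countably many gaps already do, and their lower ends have supremum \<open>z\<close>.\<close>

lemma completion_super_order_dense:
  assumes "countable_sup_property TYPE('a)" "0 < z"
  shows "\<exists>y::nat \<Rightarrow> 'a. (\<forall>n. 0 \<le> y n) \<and> (\<forall>n. j (y n) \<le> z) \<and>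
    (\<forall>t. (\<forall>n. j (y n) \<le> t) \<longrightarrow> z \<le> t)"
proof -
  have z: "0 \<le> z" using assms(2) by simp
  define A where "A = {y - x |x y. 0 \<le> x \<and> j x \<le> z \<and> z \<le> j y}"
  have "isGlb UNIV A 0"
  proof (rule isGlbI)
    show "0 \<le> a" if "a \<in> A" for a
      using that completion_le_iff order_trans by (fastforce simp: A_def)
  next
    fix l assume l: "\<And>a. a \<in> A \<Longrightarrow> l \<le> a"
    \<comment> \<open>With \<open>y\<close> fixed, x \<le> y - l for all lower ends gives z \<le> j
      y - j l; varying \<open>y\<close> then gives the claim.\<close>
    have "j l + z \<le> z"
    proof (rule completion_le_if_upper)
      fix y assume y: "z \<le> j y"
      have "z \<le> j y - j l"
      proof (rule completion_le_if_lower[OF z])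
        fix x assume "0 \<le> x" "j x \<le> z"
        then have "l \<le> y - x" using l y by (auto simp: A_def)
        then have "x \<le> y - l" by (simp add: algebra_simps)
        then show "j x \<le> j y - j l" using completion_le_iff by (metis completion_diff)
      qed
      then show "j l + z \<le> j y" by (simp add: algebra_simps)
    qed
    then have "j l \<le> j 0" by (simp add: completion_zero)
    then show "l \<le> 0" by (simp only: completion_le_iff)
  qed
  then obtain S where S: "S \<subseteq> A" "countable S" "isGlb UNIV S 0"
    using assms(1) unfolding countable_sup_property_def by blast
  obtain f g where fg: "\<And>s. s \<in> S \<Longrightarrow> s = g s - f s \<and> 0 \<le> f s \<and> j (f s) \<le> z \<and> z \<le> j (g s)"
    using S(1) unfolding A_def by (simp add: subset_iff) metis
  \<comment> \<open>The extra 0 provides a value when \<open>S\<close> is empty, and it lies below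
    \<open>z\<close>.\<close>
  define y where "y = from_nat_into (insert 0 (f ` S))"
  have range: "range y = insert 0 (f ` S)"
    unfolding y_def using S(2) by (intro range_from_nat_into) auto
  have y: "y n = 0 \<or> (\<exists>s\<in>S. y n = f s)" for n
    using range by (metis image_iff insert_iff rangeI)
  have "z \<le> t" if t: "\<And>n. j (y n) \<le> t" for t
  proof -
    have ft: "j (f s) \<le> t" if "s \<in> S" for s
      using t range that by (metis image_eqI insertCI imageE)
    \<comment> \<open>As \<open>t\<close> bounds the lower ends, an element below this difference is
      below every gap g s - f s, hence at most 0.\<close>
    have "z - inf z t \<le> 0"
    proof (rule completion_le_if_lower)
      fix x assume x: "j x \<le> z - inf z t"
      have "x \<le> s" if s: "s \<in> S" for s
      proof -
        have "j x \<le> j (g s) - j (f s)"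
          using x fg[OF s] ft[OF s] by (meson diff_mono le_inf_iff order_trans)
        then show ?thesis using fg[OF s] completion_le_iff by (metis completion_diff)
      qed
      then have "x \<le> 0" by (rule isGlb_greatest[OF S(3)])
      then show "j x \<le> 0" using completion_le_iff[of x 0] by (simp add: completion_zero)
    qed (simp only: diff_ge_0_iff_ge inf_le1)
    then have "z \<le> inf z t" by (simp only: diff_le_0_iff_le)
    then show ?thesis by simp
  qed
  moreover have "0 \<le> y n \<and> j (y n) \<le> z" for n
    using y[of n] fg z by (auto simp: completion_zero)
  ultimately show ?thesis by blast
qed

text \<open>Super order density for \<open>j v - z\<close>, with \<open>v\<close> a majorant,
  reflected at \<open>v\<close>. The case \<open>z = j v\<close> is separate because the difference
  is then not positive.\<close>

lemma completion_countable_upper: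
  assumes "countable_sup_property TYPE('a)"
  shows "\<exists>U. countable U \<and> (\<forall>u\<in>U. z \<le> j u) \<and> (\<forall>l. (\<forall>u\<in>U. l \<le> j u) \<longrightarrow> l \<le> z)"
proof -
  obtain v where v: "z \<le> j v" using completion_majorizing by blast
  show ?thesis
  proof (cases "z = j v")
    case True
    then show ?thesis by (intro exI[of _ "{v}"]) simp
  next
    case False
    with v have "0 < j v - z" by (simp add: less_le)
    from completion_super_order_dense[OF assms this] obtain y :: "nat \<Rightarrow> 'a" where
      y: "\<And>n. j (y n) \<le> j v - z" "\<And>t. (\<And>n. j (y n) \<le> t) \<Longrightarrow> j v - z \<le> t" by blast
    have "l \<le> z" if l: "\<And>n. l \<le> j (v - y n)" for l
    proof -
      have "j v - z \<le> j v - l"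
        using l by (intro y(2)) (simp add: completion_diff algebra_simps)
      then show ?thesis by simp
    qed
    moreover have "z \<le> j (v - y n)" for n
      using y(1)[of n] by (simp add: completion_diff algebra_simps)
    ultimately show ?thesis
      by (intro exI[of _ "range (\<lambda>n. v - y n)"]) auto
  qed
qed

lemma countable_sup_property_imp_almost_sigma_order_complete:
  assumes "countable_sup_property TYPE('a)"
  shows "almost_sigma_order_complete TYPE('a)"
  by (rule almost_sigma_order_complete_if_super_order_dense[OF linear_completion inj_completion
        completion_sup completion_super_order_dense[OF assms]])

section \<open>Transfer between a space and its completion\<close>

text \<open>A set in the completion is replaced by its majorants from the space; below each of
  countably many selected majorants a member of the set is then chosen. Conversely, \<open>j\<close>
  preserves and reflects infimum 0.\<close>

lemma countable_sup_property_completion_iff: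
  "countable_sup_property TYPE('b) \<longleftrightarrow> countable_sup_property TYPE('a)"
proof
  assume b: "countable_sup_property TYPE('b)"
  show "countable_sup_property TYPE('a)"
    unfolding countable_sup_property_def
  proof (intro allI impI)
    fix A :: "'a set" assume "isGlb UNIV A 0"
    then obtain B where B: "B \<subseteq> j ` A" "countable B" "isGlb UNIV B 0"
      using b unfolding countable_sup_property_def isGlb_zero_completion_iff[symmetric] by blast
    then obtain A' where "countable A'" "A' \<subseteq> A" "B = j ` A'"
      using countable_subset_image[of B j A] by blast
    with B(3) show "\<exists>B\<subseteq>A. countable B \<and> isGlb UNIV B 0"
      by (auto simp: isGlb_zero_completion_iff)
  qed
next
  assume a: "countable_sup_property TYPE('a)"
  show "countable_sup_property TYPE('b)"
    unfolding countable_sup_property_def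
  proof (intro allI impI)
    fix A :: "'b set" assume A: "isGlb UNIV A 0"
    define U where "U = {u. \<exists>a\<in>A. a \<le> j u}"
    have "isGlb UNIV U 0"
      unfolding U_def using A by (rule isGlb_zero_majorants)
    then obtain V where V: "V \<subseteq> U" "countable V" "isGlb UNIV V 0"
      using a unfolding countable_sup_property_def by blast
    obtain f where f: "\<And>v. v \<in> V \<Longrightarrow> f v \<in> A \<and> f v \<le> j v"
      using V(1) unfolding U_def subset_iff mem_Collect_eq by metis
    have "isGlb UNIV (f ` V) 0"
      using f isGlbD2[OF A]
      by (intro isGlb_zero_coinitial[OF V(3)[folded isGlb_zero_completion_iff]]) auto
    then show "\<exists>B\<subseteq>A. countable B \<and> isGlb UNIV B 0"
      using f V(2) by (intro exI[of _ "f ` V"]) auto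
  qed
qed

text \<open>To descend, each \<open>c\<close> is replaced by a countable set \<open>U c\<close>
  whose image has infimum \<open>c\<close>. To ascend, the image of \<open>C\<close> serves.\<close>

lemma countable_domination_completion_iff:
  assumes csp: "countable_sup_property TYPE('a)"
  shows "countable_domination TYPE('b) \<longleftrightarrow> countable_domination TYPE('a)"
proof
  assume "countable_domination TYPE('b)"
  then obtain C :: "'b set" where C: "countable C" "\<And>c. c \<in> C \<Longrightarrow> 0 \<le> c"
    and dom: "\<And>x::nat \<Rightarrow> 'b. decseq x \<Longrightarrow> isGlb UNIV (range x) 0 \<Longrightarrow>
      \<exists>D\<subseteq>C. isGlb UNIV D 0 \<and> (\<forall>d\<in>D. \<exists>n. x n \<le> d)"
    unfolding countable_domination_def by blast
  have "\<exists>U::'a set. countable U \<and> (\<forall>u\<in>U. c \<le> j u) \<and> (\<forall>l. (\<forall>u\<in>U. l \<le> j u) \<longrightarrow> l \<le> c)" for c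
    using completion_countable_upper[OF csp] .
  then obtain U :: "'b \<Rightarrow> 'a set" where U: "\<And>c. countable (U c)" "\<And>c u. u \<in> U c \<Longrightarrow> c \<le> j u"
    "\<And>c l. (\<And>u. u \<in> U c \<Longrightarrow> l \<le> j u) \<Longrightarrow> l \<le> c"
    by metis
  define C' where "C' = (\<Union>c\<in>C. U c)"
  have "countable C'" unfolding C'_def using C(1) U(1) by (rule countable_UN)
  moreover have "0 \<le> u" if "u \<in> C'" for u
    using that C(2) U(2) order_trans unfolding C'_def by (metis UN_E completion_nonneg_iff)
  moreover have "\<exists>D\<subseteq>C'. isGlb UNIV D 0 \<and> (\<forall>d\<in>D. \<exists>n. x n \<le> d)"
    if x: "decseq x" "isGlb UNIV (range x) 0" for x :: "nat \<Rightarrow> 'a"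
  proof -
    have "decseq (\<lambda>n. j (x n))" using x(1) by (simp add: decseq_def completion_le_iff)
    moreover have "isGlb UNIV (range (\<lambda>n. j (x n))) 0"
      using x(2) isGlb_zero_completion_iff[of "range x"] by (simp add: image_image)
    ultimately obtain D where D: "D \<subseteq> C" "isGlb UNIV D 0" "\<And>d. d \<in> D \<Longrightarrow> \<exists>n. j (x n) \<le> d"
      using dom[of "\<lambda>n. j (x n)"] by auto
    define D' where "D' = (\<Union>d\<in>D. U d)"
    have "isGlb UNIV (j ` D') 0"
    proof (rule isGlb_zeroI)
      show "0 \<le> a" if "a \<in> j ` D'" for a
        using that isGlbD2[OF D(2)] U(2) order_trans unfolding D'_def by blast
      show "l \<le> 0" if l: "\<And>a. a \<in> j ` D' \<Longrightarrow> l \<le> a" for l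
        by (rule isGlb_greatest[OF D(2)], rule U(3), rule l) (auto simp: D'_def)
    qed
    moreover have "\<exists>n. x n \<le> u" if "u \<in> D'" for u
    proof -
      obtain d where "d \<in> D" "d \<le> j u" using \<open>u \<in> D'\<close> U(2) unfolding D'_def by blast
      then show ?thesis using D(3) completion_le_iff order_trans by blast
    qed
    moreover have "D' \<subseteq> C'" using D(1) unfolding D'_def C'_def by blast
    ultimately show ?thesis unfolding isGlb_zero_completion_iff by blast
  qed
  ultimately show "countable_domination TYPE('a)"
    unfolding countable_domination_def by (intro exI[of _ C']) simp
next
  assume "countable_domination TYPE('a)"
  then obtain C :: "'a set" where C: "countable C" "\<And>c. c \<in> C \<Longrightarrow> 0 \<le> c"
    and dom: "\<And>x::nat \<Rightarrow> 'a. decseq x \<Longrightarrow> isGlb UNIV (range x) 0 \<Longrightarrow>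
      \<exists>D\<subseteq>C. isGlb UNIV D 0 \<and> (\<forall>d\<in>D. \<exists>n. x n \<le> d)"
    unfolding countable_domination_def by blast
  have "\<exists>D\<subseteq>j ` C. isGlb UNIV D 0 \<and> (\<forall>d\<in>D. \<exists>n. y n \<le> d)"
    if y: "decseq y" "isGlb UNIV (range y) 0" for y :: "nat \<Rightarrow> 'b"
  proof -
    \<comment> \<open>Majorants lead back to a sequence in the space, to which \<open>dom\<close>
      applies. They are closed under \<open>inf\<close> because \<open>y\<close> decreases, and each
      lies above some \<open>y n\<close>.\<close>
    define T where "T = {u. \<exists>b\<in>range y. b \<le> j u}"
    have glb: "isGlb UNIV T 0" unfolding T_def by (rule isGlb_zero_majorants[OF y(2)])
    have "T \<noteq> {}" using completion_majorizing unfolding T_def by blast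
    moreover have "inf a b \<in> T" if ab: "a \<in> T" "b \<in> T" for a b
    proof -
      obtain n m where nm: "y n \<le> j a" "y m \<le> j b" using ab unfolding T_def by blast
      have "y (max n m) \<le> j a" "y (max n m) \<le> j b"
        using nm decseqD[OF y(1)] by (meson max.cobounded1 max.cobounded2 order_trans)+
      then have "y (max n m) \<le> j (inf a b)" by (simp add: completion_inf)
      then show ?thesis unfolding T_def by blast
    qed
    ultimately obtain x :: "nat \<Rightarrow> 'a" where x: "decseq x" "range x \<subseteq> T" "isGlb UNIV (range x) 0"
      using countable_sup_property_decseq[OF csp glb] by blast
    obtain D where D: "D \<subseteq> C" "isGlb UNIV D 0" "\<And>d. d \<in> D \<Longrightarrow> \<exists>n. x n \<le> d"
      using dom[OF x(1,3)] by blast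
    have "\<exists>n. y n \<le> j d" if d: "d \<in> D" for d
    proof -
      obtain n where n: "x n \<le> d" using D(3)[OF d] by blast
      have "x n \<in> T" using x(2) by blast
      then obtain m where "y m \<le> j (x n)" unfolding T_def by blast
      then show ?thesis using n completion_le_iff order_trans by blast
    qed
    then show ?thesis
      using D(1,2) by (intro exI[of _ "j ` D"]) (auto simp: isGlb_zero_completion_iff)
  qed
  moreover have "countable (j ` C)" "\<forall>c\<in>j ` C. 0 \<le> c"
    using C by (auto simp: completion_nonneg_iff)
  ultimately show "countable_domination TYPE('b)"
    unfolding countable_domination_def by (intro exI[of _ "j ` C"]) simp
qed

end

section \<open>Assembly of the equivalences\<close>

theorem theorem4p18:
  fixes j :: "'a::archimedean_vector_lattice \<Rightarrow> 'b::dedekind_complete_vector_lattice"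
  assumes "dedekind_completion j"
  shows
    "(order_strongly_first_countable TYPE('a) \<longleftrightarrow>
        sigma_order_strongly_first_countable TYPE('a) \<and> countable_sup_property TYPE('a)) \<and>
     (order_strongly_first_countable TYPE('a) \<longleftrightarrow>
        sigma_order_strongly_first_countable TYPE('a) \<and> almost_sigma_order_complete TYPE('a)) \<and>
     (order_strongly_first_countable TYPE('a) \<longleftrightarrow>
        almost_sigma_order_complete TYPE('a) \<and>
        (\<exists>C::'a set. countable C \<and> (\<forall>c\<in>C. 0 \<le> c) \<and>
          (\<forall>x::nat \<Rightarrow> 'a. decseq x \<and> isGlb UNIV (range x) 0 \<longrightarrow>
            (\<exists>D\<subseteq>C. isGlb UNIV D 0 \<and> (\<forall>d\<in>D. \<exists>n. x n \<le> d))))) \<and>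
     (order_strongly_first_countable TYPE('a) \<longleftrightarrow> sigma_order_strongly_first_countable TYPE('b)) \<and>
     (order_strongly_first_countable TYPE('a) \<longleftrightarrow> order_strongly_first_countable TYPE('b))"
proof -
  \<comment> \<open>The completion is almost \<sigma>-order complete, so there domination yields the
    countable supremum property and both forms of strong first countability agree.\<close>
  have b: "sigma_order_strongly_first_countable TYPE('b) \<longleftrightarrow> order_strongly_first_countable TYPE('b)"
    using order_strongly_first_countable_imp_sigma[where 'a = 'b]
      sigma_order_strongly_first_countable_imp_countable_domination[where 'a = 'b]
      dedekind_complete_imp_almost_sigma_order_complete[where 'b = 'b]
      countable_sup_propertyI[where 'a = 'b] order_strongly_first_countable_iff[where 'a = 'b]
    by blast
  have ab: "order_strongly_first_countable TYPE('b) \<longleftrightarrow> order_strongly_first_countable TYPE('a)"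
    using countable_sup_property_completion_iff[OF assms] countable_domination_completion_iff[OF assms]
      order_strongly_first_countable_iff[where 'a = 'a] order_strongly_first_countable_iff[where 'a = 'b]
    by blast
  note facts = order_strongly_first_countable_iff[where 'a = 'a]
    order_strongly_first_countable_imp_sigma[where 'a = 'a]
    sigma_order_strongly_first_countable_imp_countable_domination[where 'a = 'a]
    countable_sup_propertyI[where 'a = 'a]
    countable_sup_property_imp_almost_sigma_order_complete[OF assms]
  have "order_strongly_first_countable TYPE('a) \<longleftrightarrow>
      sigma_order_strongly_first_countable TYPE('a) \<and> countable_sup_property TYPE('a)"
    using facts by blast
  \<comment> \<open>The countable supremum property gives almost \<sigma>-order completeness through
    the completion; backwards, almost \<sigma>-order completeness and domination give that
    property.\<close>
  moreover have "order_strongly_first_countable TYPE('a) \<longleftrightarrow>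
      sigma_order_strongly_first_countable TYPE('a) \<and> almost_sigma_order_complete TYPE('a)"
    using facts by blast
  moreover have "order_strongly_first_countable TYPE('a) \<longleftrightarrow>
      almost_sigma_order_complete TYPE('a) \<and> countable_domination TYPE('a)"
    using facts by blast
  ultimately show ?thesis
    using b ab unfolding countable_domination_def by (intro conjI) simp_all
qed

end
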